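(* Let $(M,q,B,g,\mathcal{E})$ be a submersed ambient structure and let $A$ be the O'Neill tensor. The map $\mathfrak{j}_{\mathcal{H}}$ defined by $$\mathfrak{j}_{\mathcal{H}}:(x,v,\Delta_m,\Delta_t)\mapsto(x,\mathrm{H}_x\Delta_m,v,(D_v\mathrm{H})_x\Delta_m+\mathrm{H}_x\Delta_t)=(x,\mathrm{H}_x\Delta_m,v,2A_v\Delta_m+\Delta_t)$$ maps $T\mathcal{H}M$ to $\mathcal{Q}\mathcal{H}M$. Restricted to $\mathcal{Q}\mathcal{H}M$, it is an involution. It corresponds to the canonical flip of $TTB$: if $d^2q$ maps $(x,v,\delta_m,\delta_t)\in\mathcal{Q}\mathcal{H}M$ to $(b,w,\delta_b,\delta_w)\in TTB$, then it maps $(x,\delta_m,v,(D_v\mathrm{H})_x\delta_m+\mathrm{H}_x\delta_t)$ to $(b,\delta_b,w,\delta_w)$.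
   Context: $\mathcal{E}$ is a finite-dimensional inner product space; $M\subset\mathcal{E}$ is a differentiably embedded Riemannian manifold with metric operator $g$: a smooth map $M\to L(\mathcal{E},\mathcal{E})$ with $g_x$ self-adjoint positive-definite and $\langle\xi,g_x\eta\rangle_{\mathcal{E}}$ the Riemannian inner product of $\xi,\eta\in T_xM\subset\mathcal{E}$. A submersed ambient structure $(M,q,B,g,\mathcal{E})$ is this data together with a Riemannian submersion $q:M\to B$. $\mathcal{V}M=\ker dq$; $\mathcal{H}M$ is its orthogonal complement in $TM$. $\Pi_x,\mathrm{H}_x,\mathrm{V}_x$ are the projections of $\mathcal{E}$ onto $T_xM,\mathcal{H}_xM,\mathcal{V}_xM$, orthogonal for $\langle\cdot,g_x\cdot\rangle_{\mathcal{E}}$, regarded as smooth $L(\mathcal{E},\mathcal{E})$-valued functions on $M$; $D$ is directional derivative. $\mathcal{H}M=\{(x,v):x\in M,\mathrm{H}_xv=v\}\subset\mathcal{E}^2$; $T\mathcal{H}M\subset\mathcal{E}^4$ consists of $(x,v,\Delta_m,\Delta_t)$ with $(x,v)\in\mathcal{H}M$, $\Pi_x\Delta_m=\Delta_m$ and $(D_{\Delta_m}\mathrm{H})_xv+\mathrm{H}_x\Delta_t=\Delta_t$; $\mathcal{Q}\mathcal{H}M\subset T\mathcal{H}M$ is the subbundle where in addition $\mathrm{H}_x\Delta_m=\Delta_m$. $d^2q$ is the differential of $dq|_{\mathcal{H}M}:\mathcal{H}M\to TB$. The O'Neill tensor is $A_\xi\eta=\mathrm{V}\nabla_\xi(\mathrm{H}\eta)$,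 $\nabla$ the Levi-Civita connection of $M$. $B$ is embedded in an inner product space $\mathcal{E}_B$, so $TTB\subset\mathcal{E}_B^4$, and the canonical flip of $TTB$ is $(b,w,\delta_b,\delta_w)\mapsto(b,\delta_b,w,\delta_w)$.
   Formalization: The equality of the two expressions for j_H (the form with 2A_vΔ_m+Δ_t) is proved only on QHM; on all of THM it is false, e.g. M=R²\{0}, q(x)=|x|, x=v=e1, Δ_m=Δ_t=e2, where the last components are 0 and e2. *)

theory Defs
  imports "HOL-Analysis.Analysis"
begin

section \<open>Smooth maps and embedded submanifolds\<close>

text \<open>On an open subset of a Euclidean space this is the usual notion of a \<open>C\<^sup>k\<close> map: the
  derivative is tested in each fixed direction \<open>v\<close>. It is only used for open \<open>U\<close>.\<close>

primrec Ck_on ::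
    "nat \<Rightarrow> 'a::euclidean_space set \<Rightarrow> ('a \<Rightarrow> 'b::real_normed_vector) \<Rightarrow> bool" where
  "Ck_on 0 U f \<longleftrightarrow> continuous_on U f"
| "Ck_on (Suc k) U f \<longleftrightarrow> (\<forall>x\<in>U. f differentiable (at x)) \<and>
     (\<forall>v. Ck_on k U (\<lambda>x. frechet_derivative f (at x) v))"

definition smooth_open :: "'a::euclidean_space set \<Rightarrow> ('a \<Rightarrow> 'b::real_normed_vector) \<Rightarrow> bool" where
  "smooth_open U f \<longleftrightarrow> (\<forall>k. Ck_on k U f)"

text \<open>Smoothness of a map on a submanifold \<open>M\<close>: it has local smooth extensions to the ambient
  space. The values of \<open>f\<close> outside \<open>M\<close> do not matter.\<close>

definition smooth_map :: "'a::euclidean_space set \<Rightarrow> ('a \<Rightarrow> 'b::real_normed_vector) \<Rightarrow> bool" where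
  "smooth_map M f \<longleftrightarrow> (\<forall>x\<in>M. \<exists>U F. open U \<and> x \<in> U \<and> smooth_open U F \<and> (\<forall>y\<in>M \<inter> U. F y = f y))"

definition embedded_submanifold :: "'a::euclidean_space set \<Rightarrow> bool" where
  "embedded_submanifold M \<longleftrightarrow>
     (\<exists>d. \<forall>x\<in>M. \<exists>U W S. \<exists>\<phi> \<psi> :: 'a \<Rightarrow> 'a.
        open U \<and> x \<in> U \<and> open W \<and> homeomorphism U W \<phi> \<psi> \<and> smooth_open U \<phi> \<and> smooth_open W \<psi> \<and>
        subspace S \<and> dim S = d \<and> \<phi> ` (M \<inter> U) = W \<inter> S)"

definition tangent_space :: "'a::euclidean_space set \<Rightarrow> 'a \<Rightarrow> 'a set" where
  "tangent_space M x =
     {v. \<exists>(\<gamma>::real \<Rightarrow> 'a) e. e > 0 \<and> smooth_open {-e<..<e} \<gamma> \<and> \<gamma> ` {-e<..<e} \<subseteq> M \<and>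
           \<gamma> 0 = x \<and> (\<gamma> has_vector_derivative v) (at 0)}"

text \<open>The directional derivative \<open>(D\<^sub>v f)\<^sub>x\<close> of a map \<open>f\<close> on \<open>M\<close>. A derivative within \<open>M\<close>
  is a linear map on the ambient space which is determined only on \<^term>\<open>tangent_space M x\<close>;
  \<open>v\<close> is always taken from there.\<close>

definition dird ::
    "'a::real_normed_vector set \<Rightarrow> ('a \<Rightarrow> 'b::real_normed_vector) \<Rightarrow> 'a \<Rightarrow> 'a \<Rightarrow> 'b" where
  "dird M f x v = frechet_derivative f (at x within M) v"


section \<open>Submersed ambient structures\<close>

definition metric_operator ::
    "'a::euclidean_space set \<Rightarrow> ('a \<Rightarrow> 'a \<Rightarrow>\<^sub>L 'a) \<Rightarrow> bool" where
  "metric_operator M g \<longleftrightarrow> smooth_map M g \<and>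
     (\<forall>x\<in>M. (\<forall>u v. g x u \<bullet> v = u \<bullet> g x v) \<and> (\<forall>u. u \<noteq> 0 \<longrightarrow> u \<bullet> g x u > 0))"

definition vert ::
    "'a::euclidean_space set \<Rightarrow> ('a \<Rightarrow> 'b::euclidean_space) \<Rightarrow> 'a \<Rightarrow> 'a set" where
  "vert M q x = {v \<in> tangent_space M x. dird M q x v = 0}"

definition horiz ::
    "'a::euclidean_space set \<Rightarrow> ('a \<Rightarrow> 'b::euclidean_space) \<Rightarrow> ('a \<Rightarrow> 'a \<Rightarrow>\<^sub>L 'a) \<Rightarrow> 'a \<Rightarrow> 'a set" where
  "horiz M q g x = {u \<in> tangent_space M x. \<forall>v\<in>vert M q x. u \<bullet> g x v = 0}"

text \<open>The metric of \<open>B\<close> is also given by a metric operator \<open>gB\<close>. This is no restriction: a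
  Riemannian metric on an embedded manifold always extends to a metric operator, for instance by
  the ambient inner product on the orthogonal complements of the tangent spaces.\<close>

definition submersed_ambient_structure ::
    "'a::euclidean_space set \<Rightarrow> ('a \<Rightarrow> 'b::euclidean_space) \<Rightarrow> 'b set \<Rightarrow>
     ('a \<Rightarrow> 'a \<Rightarrow>\<^sub>L 'a) \<Rightarrow> ('b \<Rightarrow> 'b \<Rightarrow>\<^sub>L 'b) \<Rightarrow> bool" where
  "submersed_ambient_structure M q B g gB \<longleftrightarrow>
     embedded_submanifold M \<and> metric_operator M g \<and>
     embedded_submanifold B \<and> metric_operator B gB \<and>
     smooth_map M q \<and> q ` M \<subseteq> B \<and>
     (\<forall>x\<in>M. dird M q x ` tangent_space M x = tangent_space B (q x)) \<and>
     (\<forall>x\<in>M. \<forall>u\<in>horiz M q g x. \<forall>w\<in>horiz M q g x.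
        dird M q x u \<bullet> gB (q x) (dird M q x w) = u \<bullet> g x w)"

text \<open>The projection onto the subspace \<open>S\<close> that is orthogonal for the inner product
  \<open>\<langle>\<cdot>, G \<cdot>\<rangle>\<close>.\<close>

definition metric_proj :: "('a::euclidean_space \<Rightarrow>\<^sub>L 'a) \<Rightarrow> 'a set \<Rightarrow> 'a \<Rightarrow>\<^sub>L 'a" where
  "metric_proj G S = (THE P :: 'a \<Rightarrow>\<^sub>L 'a. \<forall>v. P v \<in> S \<and> (\<forall>s\<in>S. (v - P v) \<bullet> G s = 0))"

definition Tproj :: "'a::euclidean_space set \<Rightarrow> ('a \<Rightarrow> 'a \<Rightarrow>\<^sub>L 'a) \<Rightarrow> 'a \<Rightarrow> 'a \<Rightarrow>\<^sub>L 'a" where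
  "Tproj M g x = metric_proj (g x) (tangent_space M x)"

definition Hproj :: "'a::euclidean_space set \<Rightarrow> ('a \<Rightarrow> 'b::euclidean_space) \<Rightarrow>
    ('a \<Rightarrow> 'a \<Rightarrow>\<^sub>L 'a) \<Rightarrow> 'a \<Rightarrow> 'a \<Rightarrow>\<^sub>L 'a" where
  "Hproj M q g x = metric_proj (g x) (horiz M q g x)"

definition Vproj :: "'a::euclidean_space set \<Rightarrow> ('a \<Rightarrow> 'b::euclidean_space) \<Rightarrow>
    ('a \<Rightarrow> 'a \<Rightarrow>\<^sub>L 'a) \<Rightarrow> 'a \<Rightarrow> 'a \<Rightarrow>\<^sub>L 'a" where
  "Vproj M q g x = metric_proj (g x) (vert M q x)"


section \<open>The Levi-Civita connection and the O'Neill tensor\<close>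

definition vector_field :: "'a::euclidean_space set \<Rightarrow> ('a \<Rightarrow> 'a) \<Rightarrow> bool" where
  "vector_field M X \<longleftrightarrow> smooth_map M X \<and> (\<forall>x\<in>M. X x \<in> tangent_space M x)"

definition affine_connection ::
    "'a::euclidean_space set \<Rightarrow> (('a \<Rightarrow> 'a) \<Rightarrow> ('a \<Rightarrow> 'a) \<Rightarrow> 'a \<Rightarrow> 'a) \<Rightarrow> bool" where
  "affine_connection M nabla \<longleftrightarrow>
     (\<forall>X Y. vector_field M X \<longrightarrow> vector_field M Y \<longrightarrow> vector_field M (nabla X Y)) \<and>
     (\<forall>X X' Y. vector_field M X \<longrightarrow> vector_field M X' \<longrightarrow> vector_field M Y \<longrightarrow>
        (\<forall>x\<in>M. nabla (\<lambda>y. X y + X' y) Y x = nabla X Y x + nabla X' Y x)) \<and>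
     (\<forall>f X Y. smooth_map M f \<longrightarrow> vector_field M X \<longrightarrow> vector_field M Y \<longrightarrow>
        (\<forall>x\<in>M. nabla (\<lambda>y. f y *\<^sub>R X y) Y x = f x *\<^sub>R nabla X Y x)) \<and>
     (\<forall>X Y Y'. vector_field M X \<longrightarrow> vector_field M Y \<longrightarrow> vector_field M Y' \<longrightarrow>
        (\<forall>x\<in>M. nabla X (\<lambda>y. Y y + Y' y) x = nabla X Y x + nabla X Y' x)) \<and>
     (\<forall>f X Y. smooth_map M f \<longrightarrow> vector_field M X \<longrightarrow> vector_field M Y \<longrightarrow>
        (\<forall>x\<in>M. nabla X (\<lambda>y. f y *\<^sub>R Y y) x = dird M f x (X x) *\<^sub>R Y x + f x *\<^sub>R nabla X Y x))"

text \<open>In the torsion-free condition, \<open>D\<^sub>X Y - D\<^sub>Y X\<close> is the Lie bracket \<open>[X, Y]\<close> in ambient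
  coordinates.\<close>

definition levi_civita :: "'a::euclidean_space set \<Rightarrow> ('a \<Rightarrow> 'a \<Rightarrow>\<^sub>L 'a) \<Rightarrow>
    (('a \<Rightarrow> 'a) \<Rightarrow> ('a \<Rightarrow> 'a) \<Rightarrow> 'a \<Rightarrow> 'a) \<Rightarrow> bool" where
  "levi_civita M g nabla \<longleftrightarrow> affine_connection M nabla \<and>
     (\<forall>X Y. vector_field M X \<longrightarrow> vector_field M Y \<longrightarrow>
        (\<forall>x\<in>M. nabla X Y x - nabla Y X x = dird M Y x (X x) - dird M X x (Y x))) \<and>
     (\<forall>X Y Z. vector_field M X \<longrightarrow> vector_field M Y \<longrightarrow> vector_field M Z \<longrightarrow>
        (\<forall>x\<in>M. dird M (\<lambda>y. Y y \<bullet> g y (Z y)) x (X x) =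
           nabla X Y x \<bullet> g x (Z x) + Y x \<bullet> g x (nabla X Z x)))"

text \<open>\<open>A\<^sub>v w\<close> at the point \<open>x\<close>: the common value at \<open>x\<close> of \<open>V \<nabla>\<^sub>\<xi> (H \<eta>)\<close> for all vector
  fields \<open>\<xi>\<close>, \<open>\<eta>\<close> extending the tangent vectors \<open>v\<close>, \<open>w\<close>.\<close>

definition oneill :: "'a::euclidean_space set \<Rightarrow> ('a \<Rightarrow> 'b::euclidean_space) \<Rightarrow>
    ('a \<Rightarrow> 'a \<Rightarrow>\<^sub>L 'a) \<Rightarrow> (('a \<Rightarrow> 'a) \<Rightarrow> ('a \<Rightarrow> 'a) \<Rightarrow> 'a \<Rightarrow> 'a) \<Rightarrow> 'a \<Rightarrow> 'a \<Rightarrow> 'a \<Rightarrow> 'a" where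
  "oneill M q g nabla x v w =
     (THE a. \<forall>\<xi> \<eta>. vector_field M \<xi> \<longrightarrow> vector_field M \<eta> \<longrightarrow> \<xi> x = v \<longrightarrow> \<eta> x = w \<longrightarrow>
        Vproj M q g x (nabla \<xi> (\<lambda>y. Hproj M q g y (\<eta> y)) x) = a)"


section \<open>The horizontal bundle and its tangent bundle\<close>

definition HM :: "'a::euclidean_space set \<Rightarrow> ('a \<Rightarrow> 'b::euclidean_space) \<Rightarrow>
    ('a \<Rightarrow> 'a \<Rightarrow>\<^sub>L 'a) \<Rightarrow> ('a \<times> 'a) set" where
  "HM M q g = {(x, v). x \<in> M \<and> Hproj M q g x v = v}"

definition THM :: "'a::euclidean_space set \<Rightarrow> ('a \<Rightarrow> 'b::euclidean_space) \<Rightarrow>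
    ('a \<Rightarrow> 'a \<Rightarrow>\<^sub>L 'a) \<Rightarrow> ('a \<times> 'a \<times> 'a \<times> 'a) set" where
  "THM M q g = {(x, v, \<Delta>m, \<Delta>t). (x, v) \<in> HM M q g \<and> Tproj M g x \<Delta>m = \<Delta>m \<and>
     dird M (Hproj M q g) x \<Delta>m v + Hproj M q g x \<Delta>t = \<Delta>t}"

definition QHM :: "'a::euclidean_space set \<Rightarrow> ('a \<Rightarrow> 'b::euclidean_space) \<Rightarrow>
    ('a \<Rightarrow> 'a \<Rightarrow>\<^sub>L 'a) \<Rightarrow> ('a \<times> 'a \<times> 'a \<times> 'a) set" where
  "QHM M q g = {(x, v, \<Delta>m, \<Delta>t). (x, v, \<Delta>m, \<Delta>t) \<in> THM M q g \<and> Hproj M q g x \<Delta>m = \<Delta>m}"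

definition jH :: "'a::euclidean_space set \<Rightarrow> ('a \<Rightarrow> 'b::euclidean_space) \<Rightarrow>
    ('a \<Rightarrow> 'a \<Rightarrow>\<^sub>L 'a) \<Rightarrow> 'a \<times> 'a \<times> 'a \<times> 'a \<Rightarrow> 'a \<times> 'a \<times> 'a \<times> 'a" where
  "jH M q g = (\<lambda>(x, v, \<Delta>m, \<Delta>t).
     (x, Hproj M q g x \<Delta>m, v, dird M (Hproj M q g) x v \<Delta>m + Hproj M q g x \<Delta>t))"

definition dq :: "'a::euclidean_space set \<Rightarrow> ('a \<Rightarrow> 'b::euclidean_space) \<Rightarrow> 'a \<times> 'a \<Rightarrow> 'b \<times> 'b" where
  "dq M q = (\<lambda>(x, v). (q x, dird M q x v))"

text \<open>The differential of the restriction of \<^term>\<open>dq M q\<close> to the submanifold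
  \<^term>\<open>HM M q g\<close> of \<open>'a \<times> 'a\<close>, on tangent vectors with their base points.\<close>

definition d2q :: "'a::euclidean_space set \<Rightarrow> ('a \<Rightarrow> 'b::euclidean_space) \<Rightarrow>
    ('a \<Rightarrow> 'a \<Rightarrow>\<^sub>L 'a) \<Rightarrow> 'a \<times> 'a \<times> 'a \<times> 'a \<Rightarrow> 'b \<times> 'b \<times> 'b \<times> 'b" where
  "d2q M q g = (\<lambda>(x, v, \<delta>m, \<delta>t).
     (let (b, w) = dq M q (x, v); (\<delta>b, \<delta>w) = dird (HM M q g) (dq M q) (x, v) (\<delta>m, \<delta>t)
      in (b, w, \<delta>b, \<delta>w)))"

end

theory Submission
  imports Defs
begin

text \<open>
  Write \<open>P\<close>, \<open>H\<close>, \<open>V\<close> for the projections onto the tangent, horizontal and vertical spaces and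
  \<open>(D\<^sub>v H) w\<close> for the directional derivative of \<open>H\<close> along \<open>v\<close>, applied to \<open>w\<close>. Everything follows
  from two facts about \<open>D H\<close>.

  First, \<open>H\<close> is idempotent, and differentiating \<open>H H = H\<close> gives
  \<open>(D\<^sub>v H) u = H ((D\<^sub>v H) u) + (D\<^sub>v H) (H u)\<close>; in particular \<open>H ((D\<^sub>v H) u) = 0\<close> for horizontal \<open>u\<close>
  (\<open>dird_H_split\<close>, \<open>H_dird_H\<close>). The first identity is the equation that the image of
  \<open>(x, v, \<Delta>m, \<Delta>t)\<close> must satisfy in order to lie in \<open>\<Q>\<H>M\<close>, and the second one makes the map an
  involution there.

  Secondly, for horizontal \<open>v\<close>, \<open>w\<close> the vector \<open>(D\<^sub>v H) w - (D\<^sub>w H) v\<close> is vertical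
  (\<open>bracket_vertical\<close>). It is the Lie bracket at \<open>x\<close> of the horizontal fields \<open>y \<mapsto> H\<^sub>y v\<close> and
  \<open>y \<mapsto> H\<^sub>y w\<close>, so it is tangent to \<open>M\<close>, and \<open>H\<close> kills it by the first fact. Hence \<open>dq\<close> kills it as
  well. The second-order part of \<open>d\<^sup>2q\<close> at \<open>(x, v, \<delta>m, \<delta>t)\<close> is the derivative along \<open>\<delta>m\<close> of the
  function \<open>y \<mapsto> dq\<^sub>y (H\<^sub>y v)\<close>, plus the term \<open>dq (H \<delta>t)\<close>, which is the same at the
  flipped point. As second derivatives of \<open>q\<close> are symmetric (\<open>dird_commutator\<close>), exchanging \<open>v\<close> and
  \<open>\<delta>m\<close> changes that derivative by \<open>dq\<close> of the bracket, that is, not at all. This is the compatibility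
  with the canonical flip (\<open>d2q_flip\<close>).

  The form of the map with the O'Neill tensor is the classical identity \<open>2 A\<^sub>v w = V [v, w]\<close> for
  horizontal \<open>v\<close>, \<open>w\<close>, where the bracket is the vertical vector above (\<open>V_nabla_horizontal\<close>). The
  Koszul formula, written with ambient derivatives of the vector fields and of the metric operator,
  shows that \<open>V \<nabla>\<^sub>\<xi> (H \<eta>)\<close> depends only on the values of \<open>\<xi>\<close> and \<open>\<eta>\<close> at \<open>x\<close>. Its part symmetric in
  \<open>v\<close>, \<open>w\<close> is, up to a factor, the Lie derivative of the metric along vertical fields, restricted to
  horizontal vectors; it vanishes because there the metric is the pull-back of the metric of \<open>B\<close>
  (\<open>vertical_metric_derivative\<close>).

  All this needs \<open>H\<close> to be smooth. Locally the tangent spaces are the ranges of a smooth family of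
  projections read off from a chart, and making them orthogonal for \<open>g\<close> only takes the inverse of
  a positive definite operator (\<open>metric_proj_formula\<close>); so \<open>P\<close> is smooth. As \<open>dq\<close> is isometric on
  horizontal vectors, \<open>H\<close> is the product of \<open>dq P\<close> with its adjoint for the metrics \<open>g\<close> and
  \<open>g\<^sub>B\<close> (\<open>H_formula\<close>), and is therefore smooth as well.
\<close>

section \<open>Calculus of \<open>C\<^sup>k\<close> maps\<close>

lemma Ck_on_subset: "Ck_on k U f \<Longrightarrow> V \<subseteq> U \<Longrightarrow> Ck_on k V f"
  by (induction k arbitrary: f) (auto intro: continuous_on_subset)

lemma Ck_on_cong:
  assumes "open U" "\<And>x. x \<in> U \<Longrightarrow> f x = h x" "Ck_on k U f"
  shows "Ck_on k U h"
  using assms(2,3)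
proof (induction k arbitrary: f h)
  case 0
  then show ?case by (auto cong: continuous_on_cong)
next
  case (Suc k)
  have d: "(h has_derivative frechet_derivative f (at x)) (at x)" if "x \<in> U" for x
    using has_derivative_transform_within_open[OF _ \<open>open U\<close> that, of f]
      Suc.prems that by (auto simp: frechet_derivative_works)
  then have e: "frechet_derivative h (at x) = frechet_derivative f (at x)" if "x \<in> U" for x
    using frechet_derivative_at that by metis
  have "Ck_on k U (\<lambda>x. frechet_derivative h (at x) v)" for v
    by (rule Suc.IH[of "\<lambda>x. frechet_derivative f (at x) v"]) (use Suc.prems e in auto)
  with d show ?case by (auto simp: differentiable_def)
qed

text \<open>The derivative need not be given as a Frechet derivative, which makes induction on \<open>k\<close> with
  the usual differentiation rules possible.\<close>

lemma Ck_on_SucI: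
  assumes "open U" "\<And>x. x \<in> U \<Longrightarrow> (f has_derivative f' x) (at x)" "\<And>v. Ck_on k U (\<lambda>x. f' x v)"
  shows "Ck_on (Suc k) U f"
proof -
  have e: "frechet_derivative f (at x) = f' x" if "x \<in> U" for x
    using assms(2)[OF that] frechet_derivative_at by metis
  show ?thesis
    using assms e by (auto simp: differentiable_def intro: Ck_on_cong[OF assms(1) _ assms(3)])
qed

lemma Ck_on_SucD:
  assumes "Ck_on (Suc k) U f"
  shows "x \<in> U \<Longrightarrow> (f has_derivative frechet_derivative f (at x)) (at x)"
    and "Ck_on k U (\<lambda>x. frechet_derivative f (at x) v)"
  using assms by (auto simp: frechet_derivative_works)

text \<open>Regularity passes to the derivatives in fixed directions, down to the case \<open>k = 0\<close>, where
  differentiability implies continuity.\<close>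

lemma Ck_on_Suc_imp: "Ck_on (Suc k) U f \<Longrightarrow> Ck_on k U f"
proof (induction k arbitrary: f)
  case 0
  then show ?case
    by (auto intro!: continuous_at_imp_continuous_on dest: differentiable_imp_continuous_within)
next
  case (Suc k)
  show ?case using Suc.prems Suc.IH by simp
qed

lemma Ck_on_const: "Ck_on k U (\<lambda>x. c)"
  by (induction k arbitrary: c) (auto simp: frechet_derivative_const)

lemma Ck_on_bounded_linear:
  assumes "bounded_linear L" "open U" "Ck_on k U f"
  shows "Ck_on k U (\<lambda>x. L (f x))"
  using assms(3)
proof (induction k arbitrary: f)
  case 0
  then show ?case using assms(1)
    by (auto intro: bounded_linear.continuous_on)
next
  case (Suc k)
  note D = Ck_on_SucD[OF Suc.prems]
  show ?case
    by (rule Ck_on_SucI[OF assms(2) bounded_linear.has_derivative[OF assms(1) D(1)] Suc.IH[OF D(2)]])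
qed

lemma Ck_on_id: "open U \<Longrightarrow> Ck_on k U (\<lambda>x. x)"
  by (cases k) (auto intro!: Ck_on_const Ck_on_SucI derivative_intros)

lemma Ck_on_add:
  assumes "open U" "Ck_on k U f" "Ck_on k U h"
  shows "Ck_on k U (\<lambda>x. f x + h x)"
  using assms(2,3)
proof (induction k arbitrary: f h)
  case 0
  then show ?case by (auto intro: continuous_intros)
next
  case (Suc k)
  note D = Ck_on_SucD[OF Suc.prems(1)] Ck_on_SucD[OF Suc.prems(2)]
  show ?case
    by (rule Ck_on_SucI[OF assms(1) has_derivative_add[OF D(1) D(3)] Suc.IH[OF D(2) D(4)]])
qed

lemma Ck_on_sum:
  assumes "open U" "\<And>i. i \<in> I \<Longrightarrow> Ck_on k U (f i)"
  shows "Ck_on k U (\<lambda>x. \<Sum>i\<in>I. f i x)"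
  using assms(2)
  by (induction I rule: infinite_finite_induct) (auto intro: Ck_on_add assms(1) Ck_on_const)

lemma Ck_on_bilinear:
  assumes "bounded_bilinear m" "open U" "Ck_on k U f" "Ck_on k U h"
  shows "Ck_on k U (\<lambda>x. m (f x) (h x))"
  using assms(3,4)
proof (induction k arbitrary: f h)
  case 0
  then show ?case using bounded_bilinear.continuous_on[OF assms(1)] by auto
next
  case (Suc k)
  note D = Ck_on_SucD[OF Suc.prems(1)] Ck_on_SucD[OF Suc.prems(2)]
  show ?case
    by (rule Ck_on_SucI[OF assms(2) bounded_bilinear.FDERIV[OF assms(1) D(1) D(3)]], assumption+)
      (intro Ck_on_add[OF assms(2)] Suc.IH[OF Ck_on_Suc_imp[OF Suc.prems(1)] D(4)]
        Suc.IH[OF D(2) Ck_on_Suc_imp[OF Suc.prems(2)]])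
qed

lemma blinfun_eq_sum_Basis:
  fixes A :: "'a::euclidean_space \<Rightarrow>\<^sub>L 'b::real_normed_vector"
  shows "A = (\<Sum>b\<in>Basis. blinfun_scaleR_left (A b) o\<^sub>L blinfun_inner_left b)"
  by (rule blinfun_euclidean_eqI)
    (simp add: blinfun.sum_left inner_Basis if_distrib[of "\<lambda>c. c *\<^sub>R _"] cong: if_cong)

lemma linear_eq_sum_Basis:
  fixes f :: "'a::euclidean_space \<Rightarrow> 'b::real_normed_vector"
  assumes "linear f"
  shows "f w = (\<Sum>b\<in>Basis. (w \<bullet> b) *\<^sub>R f b)"
proof -
  have "f w = f (\<Sum>b\<in>Basis. (w \<bullet> b) *\<^sub>R b)" by (simp add: euclidean_representation)
  also have "\<dots> = (\<Sum>b\<in>Basis. (w \<bullet> b) *\<^sub>R f b)"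
    using assms by (simp add: linear_sum linear_cmul)
  finally show ?thesis .
qed

text \<open>The chain rule expresses the derivative of the composition by \<open>f'(h x)\<close> in the varying direction
  \<open>h'(x) v\<close>, whereas \<open>Ck_on\<close> speaks of fixed directions. Expanding the direction in an
  orthonormal basis of the intermediate space reduces one to the other.\<close>

lemma Ck_on_compose:
  fixes h :: "'a::euclidean_space \<Rightarrow> 'c::euclidean_space"
  assumes "open U" "open V" "h ` U \<subseteq> V" "Ck_on k V f" "Ck_on k U h"
  shows "Ck_on k U (\<lambda>x. f (h x))"
  using assms(4,5)
proof (induction k arbitrary: f)
  case 0
  then show ?case using assms(3) by (auto intro: continuous_on_compose2)
next
  case (Suc k)
  note D = Ck_on_SucD[OF Suc.prems(1)] Ck_on_SucD[OF Suc.prems(2)]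
  have der: "((\<lambda>x. f (h x)) has_derivative
      (\<lambda>v. frechet_derivative f (at (h x)) (frechet_derivative h (at x) v))) (at x)" if "x \<in> U" for x
    using diff_chain_at[OF D(3)[OF that] D(1)] assms(3) that by (auto simp: o_def)
  have s: "(\<Sum>b\<in>Basis. (frechet_derivative h (at x) v \<bullet> b) *\<^sub>R frechet_derivative f (at (h x)) b) =
        frechet_derivative f (at (h x)) (frechet_derivative h (at x) v)" if "x \<in> U" for x v
  proof -
    have "h x \<in> V" using assms(3) that by auto
    from linear_eq_sum_Basis[OF has_derivative_linear[OF D(1)[OF this]]] show ?thesis by metis
  qed
  have "Ck_on k U (\<lambda>x. \<Sum>b\<in>Basis. (frechet_derivative h (at x) v \<bullet> b) *\<^sub>R
      frechet_derivative f (at (h x)) b)" for v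
    by (intro Ck_on_sum Ck_on_bilinear[OF bounded_bilinear_scaleR] assms(1) Suc.IH D
        Ck_on_bounded_linear[OF bounded_linear_inner_left] Ck_on_Suc_imp[OF Suc.prems(2)])
  from Ck_on_cong[OF assms(1) s this] show ?case
    by (intro Ck_on_SucI[OF assms(1) der])
qed

text \<open>An operator on a Euclidean space is the sum of its values on a basis, each multiplied by a
  coordinate function, so smoothness in each fixed direction is smoothness in the space of operators.\<close>

lemma Ck_on_blinfun_derivative:
  assumes "open U" "Ck_on (Suc k) U f"
  shows "Ck_on k U (\<lambda>x. Blinfun (frechet_derivative f (at x)))"
proof -
  note D = Ck_on_SucD[OF assms(2)]
  have s: "(\<Sum>b\<in>Basis. blinfun_scaleR_left (frechet_derivative f (at x) b) o\<^sub>L blinfun_inner_left b) =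
      Blinfun (frechet_derivative f (at x))" if "x \<in> U" for x
    using blinfun_eq_sum_Basis[of "Blinfun (frechet_derivative f (at x))"]
      has_derivative_bounded_linear[OF D(1)[OF that]]
    by (simp add: bounded_linear_Blinfun_apply)
  show ?thesis
    by (rule Ck_on_cong[OF assms(1) s], assumption)
      (intro Ck_on_sum assms D(2) Ck_on_bounded_linear[OF bounded_linear_blinfun_scaleR_left]
        Ck_on_bilinear[OF bounded_bilinear_blinfun_compose] Ck_on_const)
qed

section \<open>Symmetry of second derivatives\<close>

lemma has_real_derivative_along_line:
  fixes F :: "'a::real_normed_vector \<Rightarrow> real"
  assumes "(F has_derivative F') (at (a + s *\<^sub>R v))"
  shows "((\<lambda>s. F (a + s *\<^sub>R v)) has_real_derivative F' v) (at s)"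
proof -
  have "((\<lambda>s. a + s *\<^sub>R v) has_derivative (\<lambda>h. h *\<^sub>R v)) (at s)"
    by (auto intro!: derivative_eq_intros)
  from diff_chain_at[OF this assms] have "((\<lambda>s. F (a + s *\<^sub>R v)) has_derivative (\<lambda>h. F' (h *\<^sub>R v))) (at s)"
    by (simp add: o_def)
  moreover have "F' (h *\<^sub>R v) = F' v * h" for h
    using has_derivative_linear[OF assms] by (simp add: linear_cmul)
  ultimately show ?thesis by (simp add: has_field_derivative_def)
qed

text \<open>The mean value theorem is applied to \<open>s \<mapsto> f (x + s v + t w) - f (x + s v)\<close> and then once more, in
  the direction \<open>w\<close>, to the derivative of \<open>f\<close> in the direction \<open>v\<close>.\<close>

lemma second_difference_mean_value:
  fixes f :: "'a::euclidean_space \<Rightarrow> real"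
  assumes "Ck_on 2 U f" "t > 0"
    and U: "\<And>s r. 0 \<le> s \<Longrightarrow> s \<le> t \<Longrightarrow> 0 \<le> r \<Longrightarrow> r \<le> t \<Longrightarrow> x + s *\<^sub>R v + r *\<^sub>R w \<in> U"
  shows "\<exists>s r. 0 < s \<and> s < t \<and> 0 < r \<and> r < t \<and>
    f (x + t *\<^sub>R v + t *\<^sub>R w) - f (x + t *\<^sub>R v) - f (x + t *\<^sub>R w) + f x =
    t\<^sup>2 * frechet_derivative (\<lambda>y. frechet_derivative f (at y) v) (at (x + s *\<^sub>R v + r *\<^sub>R w)) w"
proof -
  have C: "Ck_on (Suc (Suc 0)) U f" using assms(1) by (simp only: numeral_2_eq_2)
  note D1 = Ck_on_SucD(1)[OF C] and D2 = Ck_on_SucD(1)[OF Ck_on_SucD(2)[OF C]]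
  let ?h = "\<lambda>s. f (x + t *\<^sub>R w + s *\<^sub>R v) - f (x + s *\<^sub>R v)"
  let ?h' = "\<lambda>s. frechet_derivative f (at (x + t *\<^sub>R w + s *\<^sub>R v)) v - frechet_derivative f (at (x + s *\<^sub>R v)) v"
  have "(?h has_real_derivative ?h' s) (at s)" if "0 \<le> s" "s \<le> t" for s
    using U[OF that, of t] U[OF that, of 0] \<open>t > 0\<close>
    by (intro DERIV_diff has_real_derivative_along_line D1) (auto simp: algebra_simps)
  from MVT2[OF \<open>t > 0\<close> this] obtain s where s: "0 < s" "s < t" "?h t - ?h 0 = t * ?h' s"
    by auto
  let ?k = "\<lambda>r. frechet_derivative f (at (x + s *\<^sub>R v + r *\<^sub>R w)) v"
  let ?k' = "\<lambda>r. frechet_derivative (\<lambda>y. frechet_derivative f (at y) v) (at (x + s *\<^sub>R v + r *\<^sub>R w)) w"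
  have "(?k has_real_derivative ?k' r) (at r)" if "0 \<le> r" "r \<le> t" for r
    using U[OF _ _ that, of s] s by (intro has_real_derivative_along_line D2) auto
  from MVT2[OF \<open>t > 0\<close> this] obtain r where r: "0 < r" "r < t" "?k t - ?k 0 = t * ?k' r"
    by auto
  have "?h' s = ?k t - ?k 0" by (simp add: algebra_simps)
  then have "?h t - ?h 0 = t\<^sup>2 * ?k' r"
    using s(3) r(3) by (simp add: power2_eq_square)
  moreover have "?h t - ?h 0 = f (x + t *\<^sub>R v + t *\<^sub>R w) - f (x + t *\<^sub>R v) - f (x + t *\<^sub>R w) + f x"
    by (simp add: algebra_simps)
  ultimately show ?thesis using s(1,2) r(1,2) by metis
qed

text \<open>The second difference of \<open>f\<close> over a parallelogram with sides \<open>t v\<close> and \<open>t w\<close> does not change if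
  \<open>v\<close> and \<open>w\<close> are exchanged. Divided by \<open>t\<^sup>2\<close>, it is a value of either mixed derivative near \<open>x\<close>, and
  these are continuous at \<open>x\<close>.\<close>

lemma real_second_derivative_symmetric:
  fixes f :: "'a::euclidean_space \<Rightarrow> real"
  assumes "open U" "x \<in> U" "Ck_on 2 U f"
  shows "frechet_derivative (\<lambda>y. frechet_derivative f (at y) v) (at x) w =
    frechet_derivative (\<lambda>y. frechet_derivative f (at y) w) (at x) v"
proof -
  let ?P = "\<lambda>v w y. frechet_derivative (\<lambda>y. frechet_derivative f (at y) v) (at y) w"
  have C: "continuous_on U (?P v w)" for v w
    using assms(3) by (simp add: numeral_2_eq_2)
  have near: "\<exists>d>0. \<forall>y\<in>ball x d. y \<in> U \<and> \<bar>?P v w y - ?P v w x\<bar> < e" if "e > 0" for e v w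
  proof -
    have "isCont (?P v w) x" using C assms(1,2) continuous_on_eq_continuous_at by blast
    then obtain d where "d > 0" "\<forall>y. dist y x < d \<longrightarrow> \<bar>?P v w y - ?P v w x\<bar> < e"
      using \<open>e > 0\<close> unfolding continuous_at_eps_delta dist_real_def by blast
    moreover obtain d' where "d' > 0" "ball x d' \<subseteq> U"
      using assms(1,2) openE by blast
    ultimately show ?thesis by (intro exI[of _ "min d d'"]) (auto simp: dist_commute)
  qed
  have "\<bar>?P v w x - ?P w v x\<bar> \<le> e" if "e > 0" for e
  proof -
    obtain d1 where d1: "d1 > 0" "\<And>y. y \<in> ball x d1 \<Longrightarrow> y \<in> U \<and> \<bar>?P v w y - ?P v w x\<bar> < e/2"
      using near[of "e/2" v w] \<open>e > 0\<close> by auto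
    obtain d2 where d2: "d2 > 0" "\<And>y. y \<in> ball x d2 \<Longrightarrow> y \<in> U \<and> \<bar>?P w v y - ?P w v x\<bar> < e/2"
      using near[of "e/2" w v] \<open>e > 0\<close> by auto
    define d where "d = min d1 d2"
    \<comment> \<open>small enough for the whole parallelogram to lie in the ball of radius \<open>d\<close> around \<open>x\<close>\<close>
    define t where "t = d / (2 * (norm v + norm w + 1))"
    have "d > 0" using d1 d2 by (simp add: d_def)
    have n: "norm v + norm w + 1 > 0" by (simp add: add_nonneg_pos)
    have t: "t > 0" using \<open>d > 0\<close> n by (simp add: t_def)
    have ball: "x + s *\<^sub>R v + r *\<^sub>R w \<in> ball x d" if "0 \<le> s" "s \<le> t" "0 \<le> r" "r \<le> t" for s r
    proof -
      have "dist x (x + s *\<^sub>R v + r *\<^sub>R w) = norm (s *\<^sub>R v + r *\<^sub>R w)"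
        by (metis add.assoc add_diff_cancel_left' dist_commute dist_norm)
      also have "\<dots> \<le> s * norm v + r * norm w"
        using that by (metis abs_of_nonneg norm_scaleR norm_triangle_ineq)
      also have "\<dots> \<le> t * (norm v + norm w + 1)"
        using that t by (simp add: distrib_left add_mono mult_right_mono add_increasing2)
      also have "\<dots> = d / 2" using n by (simp add: t_def field_simps)
      also have "\<dots> < d" using \<open>d > 0\<close> by simp
      finally show ?thesis by simp
    qed
    have U: "x + s *\<^sub>R v + r *\<^sub>R w \<in> U" if "0 \<le> s" "s \<le> t" "0 \<le> r" "r \<le> t" for s r
      using ball[OF that] d1(2) by (auto simp: d_def)
    obtain s r where 1: "0 < s" "s < t" "0 < r" "r < t"
      "f (x + t *\<^sub>R v + t *\<^sub>R w) - f (x + t *\<^sub>R v) - f (x + t *\<^sub>R w) + f x =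
        t\<^sup>2 * ?P v w (x + s *\<^sub>R v + r *\<^sub>R w)"
      using second_difference_mean_value[OF assms(3) t U] by blast
    have U': "x + s *\<^sub>R w + r *\<^sub>R v \<in> U" if "0 \<le> s" "s \<le> t" "0 \<le> r" "r \<le> t" for s r
      using U[OF that(3,4,1,2)] by (simp add: add_ac)
    obtain s' r' where 2: "0 < s'" "s' < t" "0 < r'" "r' < t"
      "f (x + t *\<^sub>R w + t *\<^sub>R v) - f (x + t *\<^sub>R w) - f (x + t *\<^sub>R v) + f x =
        t\<^sup>2 * ?P w v (x + s' *\<^sub>R w + r' *\<^sub>R v)"
      using second_difference_mean_value[OF assms(3) t U'] by blast
    have "t\<^sup>2 * ?P v w (x + s *\<^sub>R v + r *\<^sub>R w) = t\<^sup>2 * ?P w v (x + s' *\<^sub>R w + r' *\<^sub>R v)"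
      unfolding 1(5)[symmetric] 2(5)[symmetric] by (simp add: algebra_simps)
    then have "?P v w (x + s *\<^sub>R v + r *\<^sub>R w) = ?P w v (x + s' *\<^sub>R w + r' *\<^sub>R v)"
      using t by simp
    moreover have "\<bar>?P v w (x + s *\<^sub>R v + r *\<^sub>R w) - ?P v w x\<bar> < e/2"
      using ball[of s r] 1 by (intro d1(2)[THEN conjunct2]) (auto simp: d_def)
    moreover have "\<bar>?P w v (x + s' *\<^sub>R w + r' *\<^sub>R v) - ?P w v x\<bar> < e/2"
      using ball[of r' s'] 2 by (intro d2(2)[THEN conjunct2]) (auto simp: d_def add_ac)
    ultimately show ?thesis by linarith
  qed
  then have "\<bar>?P v w x - ?P w v x\<bar> \<le> 0"
    by (rule field_le_epsilon) simp
  then show ?thesis by simp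
qed

lemma second_derivative_symmetric:
  fixes f :: "'a::euclidean_space \<Rightarrow> 'b::euclidean_space"
  assumes "open U" "x \<in> U" "Ck_on 2 U f"
  shows "frechet_derivative (\<lambda>y. frechet_derivative f (at y) v) (at x) w =
    frechet_derivative (\<lambda>y. frechet_derivative f (at y) w) (at x) v"
proof (rule euclidean_eqI)
  fix b :: 'b assume "b \<in> Basis"
  have C: "Ck_on (Suc (Suc 0)) U f" using assms(3) by (simp only: numeral_2_eq_2)
  note D1 = Ck_on_SucD(1)[OF C] and D2 = Ck_on_SucD(1)[OF Ck_on_SucD(2)[OF C]]
  have d1: "frechet_derivative (\<lambda>y. f y \<bullet> b) (at y) = (\<lambda>v. frechet_derivative f (at y) v \<bullet> b)"
    if "y \<in> U" for y
    by (intro frechet_derivative_at[symmetric] has_derivative_inner_left D1 that)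
  have d2: "frechet_derivative (\<lambda>y. frechet_derivative (\<lambda>y. f y \<bullet> b) (at y) v) (at x) w =
      frechet_derivative (\<lambda>y. frechet_derivative f (at y) v) (at x) w \<bullet> b" for v w
  proof -
    have "((\<lambda>y. frechet_derivative f (at y) v \<bullet> b) has_derivative
        (\<lambda>w. frechet_derivative (\<lambda>y. frechet_derivative f (at y) v) (at x) w \<bullet> b)) (at x)"
      by (intro has_derivative_inner_left D2 assms)
    from has_derivative_transform_within_open[OF this assms(1,2)] d1
    have "((\<lambda>y. frechet_derivative (\<lambda>y. f y \<bullet> b) (at y) v) has_derivative
        (\<lambda>w. frechet_derivative (\<lambda>y. frechet_derivative f (at y) v) (at x) w \<bullet> b)) (at x)"
      by simp
    from frechet_derivative_at[OF this] show ?thesis by metis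
  qed
  have "Ck_on 2 U (\<lambda>y. f y \<bullet> b)"
    by (rule Ck_on_bounded_linear[OF bounded_linear_inner_left assms(1,3)])
  from real_second_derivative_symmetric[OF assms(1,2) this, of v w]
  show "frechet_derivative (\<lambda>y. frechet_derivative f (at y) v) (at x) w \<bullet> b =
    frechet_derivative (\<lambda>y. frechet_derivative f (at y) w) (at x) v \<bullet> b"
    by (simp only: d2)
qed

section \<open>Inverses and adjoints of operators\<close>

definition blinfun_inv :: "('a::euclidean_space \<Rightarrow>\<^sub>L 'a) \<Rightarrow> 'a \<Rightarrow>\<^sub>L 'a" where
  "blinfun_inv K = Blinfun (inv (blinfun_apply K))"

lemma blinfun_inv:
  assumes "inj (blinfun_apply K)"
  shows "K (blinfun_inv K u) = u" "blinfun_inv K (K u) = u"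
proof -
  have l: "linear (blinfun_apply K)" by (simp add: bounded_linear.linear blinfun.bounded_linear_right)
  have b: "bij (blinfun_apply K)"
    using assms l linear_injective_imp_surjective by (auto simp: bij_def)
  have "linear (inv (blinfun_apply K))"
    by (rule linearI; rule inv_f_eq[OF assms])
      (use b in \<open>simp_all add: blinfun.add_right blinfun.scaleR_right bij_def surj_f_inv_f\<close>)
  then have a: "blinfun_apply (blinfun_inv K) = inv (blinfun_apply K)"
    unfolding blinfun_inv_def by (intro bounded_linear_Blinfun_apply linear_conv_bounded_linear[THEN iffD1])
  show "K (blinfun_inv K u) = u" "blinfun_inv K (K u) = u"
    using b by (auto simp: a bij_def surj_f_inv_f)
qed

text \<open>A product rule in which the first factor is merely continuous at \<open>x\<close>: this suffices as the second
  factor vanishes there. It is what differentiates the inverse of an operator, for which at first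
  only continuity is known.\<close>

lemma has_derivative_prod_zero:
  assumes "bounded_bilinear m" "isCont a x" "(b has_derivative b') (at x)" "b x = 0"
  shows "((\<lambda>y. m (a y) (b y)) has_derivative (\<lambda>h. m (a x) (b' h))) (at x)"
proof -
  interpret bounded_bilinear m by fact
  have bl: "bounded_linear b'" using assms(3) by (rule has_derivative_bounded_linear)
  obtain C where C: "\<And>h. norm (b' h) \<le> norm h * C"
    using bounded_linear.bounded[OF bl] by blast
  obtain P where P: "P \<ge> 0" "\<And>u w. norm (m u w) \<le> norm u * norm w * P"
    using nonneg_bounded by blast
  define e where "e y = norm (b y - b' (y - x)) / norm (y - x)" for y
  have e: "(e \<longlongrightarrow> 0) (at x)"
    using assms(3,4) by (simp add: has_derivative_iff_norm e_def[abs_def])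
  have "((\<lambda>y. norm (a y - a x) * (e y + C) * P) \<longlongrightarrow> norm (a x - a x) * (0 + C) * P) (at x)"
    using assms(2) e by (intro tendsto_intros) (auto simp: isCont_def)
  then have lim: "((\<lambda>y. norm (a y - a x) * (e y + C) * P) \<longlongrightarrow> 0) (at x)" by simp
  have bnd: "norm (m (a y - a x) (b y)) / norm (y - x) \<le> norm (a y - a x) * (e y + C) * P"
    if "y \<noteq> x" for y
  proof -
    have "norm (b y) \<le> norm (b y - b' (y - x)) + norm (b' (y - x))"
      using norm_triangle_sub by (metis add.commute)
    also have "\<dots> \<le> (e y + C) * norm (y - x)"
      using that C[of "y - x"] by (simp add: e_def field_simps)
    finally have "norm (a y - a x) * norm (b y) * P \<le> norm (a y - a x) * ((e y + C) * norm (y - x)) * P"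
      using P(1) by (intro mult_right_mono mult_left_mono) auto
    with P(2)[of "a y - a x" "b y"] that show ?thesis
      by (simp add: field_simps)
  qed
  have "((\<lambda>y. m (a y - a x) (b y)) has_derivative (\<lambda>h. 0)) (at x)"
    unfolding has_derivative_iff_norm
    using assms(4) by (auto simp: zero_right intro!: Lim_null_comparison[OF _ lim]
        eventually_mono[OF eventually_neq_at_within[of x]] bnd)
  moreover have "((\<lambda>y. m (a x) (b y)) has_derivative (\<lambda>h. m (a x) (b' h))) (at x)"
    using assms(3) by (rule bounded_linear.has_derivative[OF bounded_linear_right])
  ultimately show ?thesis
    using has_derivative_add by (fastforce simp: diff_left)
qed

text \<open>With \<open>J y\<close> the inverse of \<open>K y\<close>, everything follows from \<open>J y - J x = - J y (K y - K x) J x\<close>. The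
  lower bound \<open>c\<close> for \<open>K\<close> bounds \<open>J\<close>, so this identity gives continuity of \<open>J\<close>; dividing it
  by the increment gives the derivative \<open>- J (D K) J\<close>; and the latter is \<open>C\<^sup>k\<close> if \<open>J\<close> is.\<close>

lemma Ck_on_blinfun_inv:
  fixes K :: "'a::euclidean_space \<Rightarrow> 'b::euclidean_space \<Rightarrow>\<^sub>L 'b"
  assumes "open U" "c > 0" "\<And>y u. y \<in> U \<Longrightarrow> c * norm u \<le> norm (K y u)" "Ck_on k U K"
  shows "Ck_on k U (\<lambda>y. blinfun_inv (K y))"
proof -
  let ?J = "\<lambda>y. blinfun_inv (K y)"
  have inj: "inj (blinfun_apply (K y))" if "y \<in> U" for y
  proof (rule injI)
    fix u v assume "K y u = K y v"
    then show "u = v"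
      using assms(3)[OF that, of "u - v"] \<open>c > 0\<close> by (simp add: blinfun.diff_right mult_le_0_iff)
  qed
  note J = blinfun_inv[OF inj]
  have bound: "norm (?J y) \<le> inverse c" if "y \<in> U" for y
  proof (rule norm_blinfun_bound)
    fix u
    have "c * norm (?J y u) \<le> norm u" using assms(3)[OF that, of "?J y u"] J(1)[OF that] by simp
    then show "norm (?J y u) \<le> inverse c * norm u"
      using \<open>c > 0\<close> by (simp add: field_simps)
  qed (use \<open>c > 0\<close> in simp)
  have diff: "?J y = ?J x - ((?J y o\<^sub>L (K y - K x)) o\<^sub>L ?J x)" if "x \<in> U" "y \<in> U" for x y
    by (rule blinfun_eqI) (simp add: blinfun.bilinear_simps J that)
  have cont: "isCont ?J x" if x: "x \<in> U" and K: "isCont K x" for x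
  proof -
    have "((\<lambda>y. inverse c * norm (K y - K x) * inverse c) \<longlongrightarrow> inverse c * norm (K x - K x) * inverse c) (at x)"
      using K by (intro tendsto_intros) (auto simp: isCont_def)
    then have "((\<lambda>y. inverse c * norm (K y - K x) * inverse c) \<longlongrightarrow> 0) (at x)" by simp
    then have "((\<lambda>y. ?J y - ?J x) \<longlongrightarrow> 0) (at x)"
    proof (rule Lim_null_comparison[rotated])
      show "\<forall>\<^sub>F y in at x. norm (?J y - ?J x) \<le> inverse c * norm (K y - K x) * inverse c"
      proof (rule eventually_mono[OF eventually_at_in_open'[OF assms(1) x]])
        fix y assume y: "y \<in> U"
        have "norm (?J y - ?J x) = norm ((?J y o\<^sub>L (K y - K x)) o\<^sub>L ?J x)"
          by (subst diff[OF x y]) simp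
        also have "\<dots> \<le> norm (?J y) * norm (K y - K x) * norm (?J x)"
          by (meson norm_blinfun_compose mult_right_mono norm_ge_zero order_trans)
        also have "\<dots> \<le> inverse c * norm (K y - K x) * inverse c"
          using \<open>c > 0\<close> bound x y by (intro mult_mono) auto
        finally show "norm (?J y - ?J x) \<le> inverse c * norm (K y - K x) * inverse c" .
      qed
    qed
    then show ?thesis unfolding isCont_def by (simp add: LIM_zero_iff)
  qed
  from assms(4) show ?thesis
  proof (induction k)
    case 0
    then show ?case using cont assms(1)
      by (auto intro!: continuous_at_imp_continuous_on simp: continuous_on_eq_continuous_at)
  next
    case (Suc k)
    note D = Ck_on_SucD[OF Suc.prems]
    have der: "(?J has_derivative (\<lambda>h. - ((?J x o\<^sub>L frechet_derivative K (at x) h) o\<^sub>L ?J x))) (at x)"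
      if x: "x \<in> U" for x
    proof -
      have "isCont K x" using D(1)[OF x] by (rule has_derivative_continuous)
      have "((\<lambda>y. K y - K x) has_derivative frechet_derivative K (at x)) (at x)"
        using has_derivative_diff[OF D(1)[OF x] has_derivative_const[of "K x"]] by simp
      from has_derivative_prod_zero[OF bounded_bilinear_blinfun_compose cont[OF x \<open>isCont K x\<close>] this]
      have "((\<lambda>y. ?J y o\<^sub>L (K y - K x)) has_derivative
          (\<lambda>h. ?J x o\<^sub>L frechet_derivative K (at x) h)) (at x)"
        by simp
      from bounded_linear.has_derivative[OF
          bounded_bilinear.bounded_linear_left[OF bounded_bilinear_blinfun_compose] this, of "?J x"]
      have "((\<lambda>y. ?J x - ((?J y o\<^sub>L (K y - K x)) o\<^sub>L ?J x)) has_derivative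
          (\<lambda>h. - ((?J x o\<^sub>L frechet_derivative K (at x) h) o\<^sub>L ?J x))) (at x)"
        using has_derivative_diff[OF has_derivative_const[of "?J x"]] by fastforce
      from has_derivative_transform_within_open[OF this assms(1) x] diff[OF x]
      show ?thesis by simp
    qed
    have J: "Ck_on k U ?J" by (rule Suc.IH[OF Ck_on_Suc_imp[OF Suc.prems]])
    show ?case
      by (rule Ck_on_SucI[OF assms(1) der])
        (auto intro!: Ck_on_bounded_linear[OF bounded_linear_minus[OF bounded_linear_ident]] assms(1) J
           Ck_on_bilinear[OF bounded_bilinear_blinfun_compose] D(2) simp del: Ck_on.simps)
  qed
qed

text \<open>The form \<open>u \<bullet> K x u\<close> has a positive minimum on the compact unit sphere, and half of it survives a
  small perturbation of \<open>K x\<close>.\<close>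

lemma positive_definite_coercive_near:
  fixes K :: "'a::euclidean_space \<Rightarrow> 'b::euclidean_space \<Rightarrow>\<^sub>L 'b"
  assumes "open U" "x \<in> U" "continuous_on U K" "\<And>u. u \<noteq> 0 \<Longrightarrow> u \<bullet> K x u > 0"
  obtains U' c where "open U'" "x \<in> U'" "U' \<subseteq> U" "c > 0"
    "\<And>y u. y \<in> U' \<Longrightarrow> c * norm u \<le> norm (K y u)"
proof -
  have "continuous_on (sphere 0 1) (\<lambda>u. u \<bullet> K x u)"
    by (intro continuous_intros)
  moreover have "sphere (0::'b) 1 \<noteq> {}" by simp
  ultimately obtain u0 where u0: "u0 \<in> sphere 0 1" "\<And>u. u \<in> sphere 0 1 \<Longrightarrow> u0 \<bullet> K x u0 \<le> u \<bullet> K x u"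
    using continuous_attains_inf[OF compact_sphere] by blast
  define c where "c = u0 \<bullet> K x u0 / 2"
  have c: "c > 0" using u0(1) assms(4)[of u0] by (cases "u0 = 0") (auto simp: c_def)
  have lower: "2 * c * (norm u)\<^sup>2 \<le> u \<bullet> K x u" for u
  proof (cases "u = 0")
    case False
    have "2 * c \<le> (u /\<^sub>R norm u) \<bullet> K x (u /\<^sub>R norm u)"
      using u0(2)[of "u /\<^sub>R norm u"] False by (simp add: c_def)
    also have "\<dots> = (u \<bullet> K x u) / (norm u)\<^sup>2"
      by (simp add: blinfun.scaleR_right power2_eq_square field_simps)
    finally show ?thesis using False by (simp add: field_simps)
  qed simp
  have "isCont K x" using assms(1-3) continuous_on_eq_continuous_at by blast
  then obtain d where d: "d > 0" "\<And>y. dist y x < d \<Longrightarrow> dist (K y) (K x) < c"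
    using c unfolding continuous_at_eps_delta by blast
  show ?thesis
  proof (rule that[of "U \<inter> ball x d" c])
    fix y u assume y: "y \<in> U \<inter> ball x d"
    have "\<bar>u \<bullet> (K y - K x) u\<bar> \<le> norm u * (norm (K y - K x) * norm u)"
      by (meson Cauchy_Schwarz_ineq2 mult_left_mono norm_blinfun norm_ge_zero order_trans)
    also have "\<dots> \<le> norm u * (c * norm u)"
      using d(2)[of y] y by (intro mult_left_mono mult_right_mono) (auto simp: dist_norm norm_minus_commute)
    finally have "\<bar>u \<bullet> (K y - K x) u\<bar> \<le> c * (norm u)\<^sup>2" by (simp add: power2_eq_square mult_ac)
    then have "c * (norm u)\<^sup>2 \<le> u \<bullet> K y u"
      using lower[of u] by (simp add: blinfun.diff_left inner_diff_right)
    also have "\<dots> \<le> norm u * norm (K y u)" by (rule norm_cauchy_schwarz)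
    finally show "c * norm u \<le> norm (K y u)"
      by (cases "u = 0") (auto simp: power2_eq_square)
  qed (use assms d c in auto)
qed

text \<open>The adjoint is written as a sum over an orthonormal basis to exhibit it as a bounded linear
  function of the operator.\<close>

definition blinfun_adj :: "('a::euclidean_space \<Rightarrow>\<^sub>L 'b::real_inner) \<Rightarrow> 'b \<Rightarrow>\<^sub>L 'a" where
  "blinfun_adj A = (\<Sum>b\<in>Basis. blinfun_scaleR_left b o\<^sub>L blinfun_inner_right (A b))"

lemma blinfun_adj_inner: "blinfun_adj A w \<bullet> u = w \<bullet> A u"
proof -
  have "blinfun_adj A w \<bullet> u = (\<Sum>b\<in>Basis. (u \<bullet> b) *\<^sub>R A b) \<bullet> w"
    by (simp add: blinfun_adj_def blinfun.sum_left inner_sum_left inner_sum_right inner_commute mult.commute)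
  also have "(\<Sum>b\<in>Basis. (u \<bullet> b) *\<^sub>R A b) = A u"
    using linear_eq_sum_Basis[of "blinfun_apply A" u]
    by (simp add: bounded_linear.linear blinfun.bounded_linear_right)
  finally show ?thesis by (simp add: inner_commute)
qed

lemma bounded_linear_blinfun_adj: "bounded_linear blinfun_adj"
  unfolding blinfun_adj_def[abs_def]
  by (intro bounded_linear_sum bounded_linear_compose[OF bounded_bilinear.bounded_linear_right[OF
        bounded_bilinear_blinfun_compose]] bounded_linear_compose[OF bounded_linear_blinfun_inner_right]
      blinfun.bounded_linear_left)

section \<open>Smooth maps on subsets of a Euclidean space\<close>

lemma smooth_mapE:
  assumes "smooth_map M f" "x \<in> M"
  obtains U F where "open U" "x \<in> U" "smooth_open U F" "\<And>y. y \<in> M \<Longrightarrow> y \<in> U \<Longrightarrow> F y = f y"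
  using assms unfolding smooth_map_def by (metis IntI)

lemma smooth_mapI:
  assumes "\<And>x. x \<in> M \<Longrightarrow> \<exists>U F. open U \<and> x \<in> U \<and> smooth_open U F \<and> (\<forall>y\<in>M \<inter> U. F y = f y)"
  shows "smooth_map M f"
  using assms by (auto simp: smooth_map_def)

lemma smooth_openD:
  assumes "smooth_open U F"
  shows "continuous_on U F" "Ck_on k U F"
    "x \<in> U \<Longrightarrow> (F has_derivative frechet_derivative F (at x)) (at x)"
proof -
  show C: "Ck_on k U F" for k using assms by (simp add: smooth_open_def)
  show "continuous_on U F" using C[of 0] by simp
  show "x \<in> U \<Longrightarrow> (F has_derivative frechet_derivative F (at x)) (at x)"
    using Ck_on_SucD(1)[OF C[of "Suc 0"]] .
qed

lemma smooth_open_subset: "smooth_open U f \<Longrightarrow> V \<subseteq> U \<Longrightarrow> smooth_open V f"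
  by (auto simp: smooth_open_def intro: Ck_on_subset)

lemma smooth_open_blinfun_derivative:
  assumes "open U" "smooth_open U f"
  shows "smooth_open U (\<lambda>x. Blinfun (frechet_derivative f (at x)))"
  using assms Ck_on_blinfun_derivative unfolding smooth_open_def by blast

lemma smooth_open_compose:
  fixes h :: "'a::euclidean_space \<Rightarrow> 'c::euclidean_space"
  assumes "open U" "open V" "h ` U \<subseteq> V" "smooth_open V f" "smooth_open U h"
  shows "smooth_open U (\<lambda>x. f (h x))"
  unfolding smooth_open_def
  by (rule allI, rule Ck_on_compose[OF assms(1-3) smooth_openD(2)[OF assms(4)] smooth_openD(2)[OF assms(5)]])

lemma smooth_open_bilinear:
  assumes "bounded_bilinear m" "open U" "smooth_open U f" "smooth_open U h"
  shows "smooth_open U (\<lambda>x. m (f x) (h x))"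
  using assms Ck_on_bilinear unfolding smooth_open_def by blast

lemma smooth_map_locally:
  assumes "\<And>x. x \<in> M \<Longrightarrow> \<exists>U. open U \<and> x \<in> U \<and> smooth_map (M \<inter> U) f"
  shows "smooth_map M f"
proof (rule smooth_mapI)
  fix x assume "x \<in> M"
  then obtain U where U: "open U" "x \<in> U" "smooth_map (M \<inter> U) f" using assms by blast
  then obtain V F where V: "open V" "x \<in> V" "smooth_open V F" "\<And>y. y \<in> M \<inter> U \<Longrightarrow> y \<in> V \<Longrightarrow> F y = f y"
    using smooth_mapE[OF U(3)] \<open>x \<in> M\<close> by blast
  with U show "\<exists>U F. open U \<and> x \<in> U \<and> smooth_open U F \<and> (\<forall>y\<in>M \<inter> U. F y = f y)"
    by (intro exI[of _ "U \<inter> V"] exI[of _ F]) (auto intro: smooth_open_subset[OF V(3)])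
qed

lemma smooth_map_subset:
  assumes "smooth_map M f" "N \<subseteq> M"
  shows "smooth_map N f"
proof (rule smooth_mapI)
  fix x assume "x \<in> N"
  with assms(2) obtain U F where U: "open U" "x \<in> U" "smooth_open U F" "\<And>y. y \<in> M \<Longrightarrow> y \<in> U \<Longrightarrow> F y = f y"
    using smooth_mapE[OF assms(1)] by blast
  with assms(2) show "\<exists>U F. open U \<and> x \<in> U \<and> smooth_open U F \<and> (\<forall>y\<in>N \<inter> U. F y = f y)"
    by (intro exI[of _ U] exI[of _ F]) auto
qed

lemma smooth_map_of_smooth_open:
  assumes "open U" "smooth_open U F" "N \<subseteq> U"
  shows "smooth_map N F"
  by (rule smooth_mapI, rule exI[of _ U], rule exI[of _ F]) (use assms in auto)

lemma smooth_map_cong: "(\<And>x. x \<in> M \<Longrightarrow> f x = h x) \<Longrightarrow> smooth_map M f \<Longrightarrow> smooth_map M h"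
  by (fastforce simp: smooth_map_def)

lemma smooth_map_const: "smooth_map M (\<lambda>x. c)"
  by (rule smooth_mapI, rule exI[of _ UNIV]) (auto simp: smooth_open_def intro!: Ck_on_const)

lemma smooth_map_bounded_linear:
  assumes "bounded_linear L" "smooth_map M f"
  shows "smooth_map M (\<lambda>x. L (f x))"
proof (rule smooth_mapI)
  fix x assume "x \<in> M"
  then obtain U F where *: "open U" "x \<in> U" "smooth_open U F" "\<And>y. y \<in> M \<Longrightarrow> y \<in> U \<Longrightarrow> F y = f y"
    using smooth_mapE[OF assms(2)] by blast
  then show "\<exists>U F. open U \<and> x \<in> U \<and> smooth_open U F \<and> (\<forall>y\<in>M \<inter> U. F y = L (f y))"
    by (intro exI[of _ U] exI[of _ "\<lambda>x. L (F x)"])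
      (auto simp: smooth_open_def intro!: Ck_on_bounded_linear[OF assms(1)])
qed

lemma smooth_map_bilinear:
  assumes "bounded_bilinear m" "smooth_map M f" "smooth_map M h"
  shows "smooth_map M (\<lambda>x. m (f x) (h x))"
proof (rule smooth_mapI)
  fix x assume "x \<in> M"
  obtain U F where U: "open U" "x \<in> U" "smooth_open U F" "\<And>y. y \<in> M \<Longrightarrow> y \<in> U \<Longrightarrow> F y = f y"
    using smooth_mapE[OF assms(2) \<open>x \<in> M\<close>] by blast
  obtain V H where V: "open V" "x \<in> V" "smooth_open V H" "\<And>y. y \<in> M \<Longrightarrow> y \<in> V \<Longrightarrow> H y = h y"
    using smooth_mapE[OF assms(3) \<open>x \<in> M\<close>] by blast
  have "smooth_open (U \<inter> V) (\<lambda>x. m (F x) (H x))"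
    using U V by (auto simp: smooth_open_def intro!: Ck_on_bilinear[OF assms(1)] intro: Ck_on_subset)
  with U V show "\<exists>U F. open U \<and> x \<in> U \<and> smooth_open U F \<and> (\<forall>y\<in>M \<inter> U. F y = m (f y) (h y))"
    by (intro exI[of _ "U \<inter> V"] exI[of _ "\<lambda>x. m (F x) (H x)"]) auto
qed

lemma smooth_map_add:
  assumes "smooth_map M f" "smooth_map M h"
  shows "smooth_map M (\<lambda>x. f x + h x)"
proof (rule smooth_mapI)
  fix x assume "x \<in> M"
  obtain U F where U: "open U" "x \<in> U" "smooth_open U F" "\<And>y. y \<in> M \<Longrightarrow> y \<in> U \<Longrightarrow> F y = f y"
    using smooth_mapE[OF assms(1) \<open>x \<in> M\<close>] by blast
  obtain V H where V: "open V" "x \<in> V" "smooth_open V H" "\<And>y. y \<in> M \<Longrightarrow> y \<in> V \<Longrightarrow> H y = h y"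
    using smooth_mapE[OF assms(2) \<open>x \<in> M\<close>] by blast
  have "smooth_open (U \<inter> V) (\<lambda>x. F x + H x)"
    using U V by (auto simp: smooth_open_def intro!: Ck_on_add intro: Ck_on_subset)
  with U V show "\<exists>U F. open U \<and> x \<in> U \<and> smooth_open U F \<and> (\<forall>y\<in>M \<inter> U. F y = f y + h y)"
    by (intro exI[of _ "U \<inter> V"] exI[of _ "\<lambda>x. F x + H x"]) auto
qed

lemma smooth_map_diff:
  assumes "smooth_map M f" "smooth_map M h"
  shows "smooth_map M (\<lambda>x. f x - h x)"
  using smooth_map_add[OF assms(1) smooth_map_bounded_linear[OF bounded_linear_minus[OF bounded_linear_ident] assms(2)]]
  by simp

lemma smooth_map_compose:
  fixes h :: "'a::euclidean_space \<Rightarrow> 'c::euclidean_space"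
  assumes "smooth_map M h" "h ` M \<subseteq> N" "smooth_map N f"
  shows "smooth_map M (\<lambda>x. f (h x))"
proof (rule smooth_mapI)
  fix x assume "x \<in> M"
  obtain U H where U: "open U" "x \<in> U" "smooth_open U H" "\<And>y. y \<in> M \<Longrightarrow> y \<in> U \<Longrightarrow> H y = h y"
    using smooth_mapE[OF assms(1) \<open>x \<in> M\<close>] by blast
  obtain V F where V: "open V" "h x \<in> V" "smooth_open V F" "\<And>y. y \<in> N \<Longrightarrow> y \<in> V \<Longrightarrow> F y = f y"
    using smooth_mapE[OF assms(3), of "h x"] assms(2) \<open>x \<in> M\<close> by blast
  define W where "W = U \<inter> H -` V"
  have W: "open W" unfolding W_def
    using continuous_open_preimage[OF smooth_openD(1)[OF U(3)] U(1) V(1)] .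
  have "x \<in> W" using U V \<open>x \<in> M\<close> by (auto simp: W_def)
  moreover have "smooth_open W (\<lambda>x. F (H x))"
    by (rule smooth_open_compose[OF W V(1) _ V(3) smooth_open_subset[OF U(3)]]) (auto simp: W_def)
  moreover have "F (H y) = f (h y)" if "y \<in> M \<inter> W" for y
    using that U(4)[of y] V(4)[of "h y"] assms(2) by (auto simp: W_def)
  ultimately show "\<exists>U F. open U \<and> x \<in> U \<and> smooth_open U F \<and> (\<forall>y\<in>M \<inter> U. F y = f (h y))"
    using W by blast
qed

text \<open>A local extension of \<open>K\<close> need not be positive definite away from \<open>M\<close>, but it stays invertible on a
  neighbourhood of each point of \<open>M\<close>.\<close>

lemma smooth_map_blinfun_inv:
  fixes K :: "'a::euclidean_space \<Rightarrow> 'b::euclidean_space \<Rightarrow>\<^sub>L 'b"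
  assumes "smooth_map M K" "\<And>x u. x \<in> M \<Longrightarrow> u \<noteq> 0 \<Longrightarrow> u \<bullet> K x u > 0"
  shows "smooth_map M (\<lambda>x. blinfun_inv (K x))"
proof (rule smooth_mapI)
  fix x assume "x \<in> M"
  obtain U F where U: "open U" "x \<in> U" "smooth_open U F" "\<And>y. y \<in> M \<Longrightarrow> y \<in> U \<Longrightarrow> F y = K y"
    using smooth_mapE[OF assms(1) \<open>x \<in> M\<close>] by blast
  have pos: "u \<noteq> 0 \<Longrightarrow> u \<bullet> F x u > 0" for u using U assms(2) \<open>x \<in> M\<close> by auto
  obtain V c where V: "open V" "x \<in> V" "V \<subseteq> U" "c > 0" "\<And>y u. y \<in> V \<Longrightarrow> c * norm u \<le> norm (F y u)"
    using positive_definite_coercive_near[OF U(1,2) smooth_openD(1)[OF U(3)] pos] by blast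
  have "smooth_open V (\<lambda>y. blinfun_inv (F y))"
    unfolding smooth_open_def
    by (intro allI Ck_on_blinfun_inv[OF V(1,4,5)] Ck_on_subset[OF smooth_openD(2)[OF U(3)] V(3)])
  with V U(4) show "\<exists>U F. open U \<and> x \<in> U \<and> smooth_open U F \<and> (\<forall>y\<in>M \<inter> U. F y = blinfun_inv (K y))"
    by (intro exI[of _ V] exI[of _ "\<lambda>y. blinfun_inv (F y)"]) auto
qed

section \<open>Directional derivatives along a subset\<close>

lemma smooth_map_has_derivative:
  assumes "open U" "x \<in> U" "x \<in> M" "smooth_open U F" "\<And>y. y \<in> M \<Longrightarrow> y \<in> U \<Longrightarrow> F y = f y"
  shows "(f has_derivative frechet_derivative F (at x)) (at x within M)"
proof -
  obtain d where d: "d > 0" "ball x d \<subseteq> U" using assms(1,2) openE by blast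
  show ?thesis
    by (rule has_derivative_transform_within[OF
          has_derivative_at_withinI[OF smooth_openD(3)[OF assms(4,2)]] d(1) assms(3)])
      (use d assms(5) in \<open>auto simp: subset_iff dist_commute\<close>)
qed

lemma smooth_map_differentiable:
  assumes "smooth_map M f" "x \<in> M"
  shows "f differentiable (at x within M)"
  using assms by (elim smooth_mapE) (auto simp: differentiable_def intro: smooth_map_has_derivative)

text \<open>Weaker than membership in \<open>tangent_space\<close> in that the curve need only be differentiable at \<open>0\<close>.
  This suffices to evaluate a derivative within \<open>M\<close>, and it makes sense for the horizontal
  bundle in the product space.\<close>

definition velocity :: "'a::real_normed_vector set \<Rightarrow> 'a \<Rightarrow> 'a \<Rightarrow> bool" where
  "velocity M x v \<longleftrightarrow> (\<exists>(\<gamma>::real \<Rightarrow> 'a) e. e > 0 \<and> \<gamma> ` {-e<..<e} \<subseteq> M \<and> \<gamma> 0 = x \<and>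
     (\<gamma> has_vector_derivative v) (at 0))"

lemma tangent_velocity: "v \<in> tangent_space M x \<Longrightarrow> velocity M x v"
  by (auto simp: tangent_space_def velocity_def)

lemma has_vector_derivative_along_curve:
  assumes "(f has_derivative f') (at x within M)"
    and "e > 0" "\<gamma> ` {-e<..<e} \<subseteq> M" "\<gamma> 0 = x" "(\<gamma> has_vector_derivative v) (at (0::real))"
  shows "((\<lambda>t. f (\<gamma> t)) has_vector_derivative f' v) (at 0)"
proof -
  have at0: "at (0::real) within {-e<..<e} = at 0"
    using \<open>e > 0\<close> by (intro at_within_open) auto
  have "(\<gamma> has_derivative (\<lambda>h. h *\<^sub>R v)) (at 0 within {-e<..<e})"
    using assms(5) by (simp add: has_vector_derivative_def at0)
  moreover have "(f has_derivative f') (at (\<gamma> 0) within \<gamma> ` {-e<..<e})"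
    using assms(1,3,4) has_derivative_subset by blast
  ultimately have "((f \<circ> \<gamma>) has_derivative (f' \<circ> (\<lambda>h. h *\<^sub>R v))) (at 0 within {-e<..<e})"
    by (rule diff_chain_within)
  then show ?thesis
    using has_derivative_linear[OF assms(1)]
    by (simp add: has_vector_derivative_def at0 o_def linear_cmul)
qed

text \<open>A derivative within \<open>M\<close> need not be unique as a linear map on the ambient space, but on the
  velocity of a curve in \<open>M\<close> any such derivative gives the velocity of the image curve. So
  \<open>dird\<close>, which is defined by a choice among them, can be computed by the usual rules in directions
  tangent to \<open>M\<close>.\<close>

lemma dird_velocity:
  assumes "(f has_derivative f') (at x within M)" "velocity M x v"
  shows "dird M f x v = f' v"
proof -
  obtain \<gamma> e where c: "e > 0" "\<gamma> ` {-e<..<e} \<subseteq> M" "\<gamma> 0 = x" "(\<gamma> has_vector_derivative v) (at (0::real))"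
    using assms(2) by (auto simp: velocity_def)
  have "(f has_derivative frechet_derivative f (at x within M)) (at x within M)"
    using assms(1) by (auto simp: frechet_derivative_works[symmetric] differentiable_def)
  from has_vector_derivative_along_curve[OF this c] has_vector_derivative_along_curve[OF assms(1) c]
  show ?thesis unfolding dird_def by (rule vector_derivative_unique_at)
qed

lemma dird_tangent:
  assumes "(f has_derivative f') (at x within M)" "v \<in> tangent_space M x"
  shows "dird M f x v = f' v"
  using dird_velocity tangent_velocity assms by blast

lemma has_derivative_dird:
  "f differentiable (at x within M) \<Longrightarrow> (f has_derivative dird M f x) (at x within M)"
  unfolding dird_def[abs_def] by (simp add: frechet_derivative_works)

text \<open>The two functions have the same derivatives within \<open>M\<close>, so that the choice made in the definition
  of \<open>dird\<close> is the same for both, in all directions.\<close>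

lemma dird_cong:
  assumes "\<And>y. y \<in> M \<Longrightarrow> f y = h y" "x \<in> M"
  shows "dird M f x = dird M h x"
proof -
  have "(f has_derivative f') (at x within M) = (h has_derivative f') (at x within M)" for f'
    using has_derivative_transform[OF assms(2), of f h] has_derivative_transform[OF assms(2), of h f]
      assms(1) by auto
  then show ?thesis by (simp add: dird_def[abs_def] frechet_derivative_def)
qed

lemma dird_bilinear:
  assumes "bounded_bilinear m" "f differentiable (at x within M)" "h differentiable (at x within M)"
    "v \<in> tangent_space M x"
  shows "dird M (\<lambda>y. m (f y) (h y)) x v = m (f x) (dird M h x v) + m (dird M f x v) (h x)"
  by (rule dird_tangent[OF bounded_bilinear.FDERIV[OF assms(1)] assms(4)])
    (intro has_derivative_dird assms)+

lemma dird_const: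
  assumes "v \<in> tangent_space M x"
  shows "dird M (\<lambda>y. c) x v = 0"
  by (rule dird_tangent[OF has_derivative_const assms])

lemma smooth_map_dird:
  assumes f: "smooth_map M f" and X: "vector_field M X"
  shows "smooth_map M (\<lambda>y. dird M f y (X y))"
proof (rule smooth_mapI)
  fix x assume x: "x \<in> M"
  obtain U F where U: "open U" "x \<in> U" "smooth_open U F" "\<And>y. y \<in> M \<Longrightarrow> y \<in> U \<Longrightarrow> F y = f y"
    using smooth_mapE[OF f x] by blast
  obtain V Z where V: "open V" "x \<in> V" "smooth_open V Z" "\<And>y. y \<in> M \<Longrightarrow> y \<in> V \<Longrightarrow> Z y = X y"
    using smooth_mapE[of M X] X x unfolding vector_field_def by blast
  let ?G = "\<lambda>y. Blinfun (frechet_derivative F (at y)) (Z y)"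
  have "smooth_open (U \<inter> V) ?G"
    using smooth_open_blinfun_derivative[OF U(1,3)] U V
    by (auto simp: smooth_open_def intro!: Ck_on_bilinear[OF bounded_bilinear_blinfun_apply] intro: Ck_on_subset)
  moreover have "?G y = dird M f y (X y)" if "y \<in> M \<inter> (U \<inter> V)" for y
  proof -
    have y: "y \<in> M" "y \<in> U" "y \<in> V" using that by auto
    show ?thesis
      using dird_tangent[OF smooth_map_has_derivative[OF U(1) y(2,1) U(3,4)], of "X y"] X y V(4)
        has_derivative_bounded_linear[OF smooth_openD(3)[OF U(3) y(2)]]
      by (simp add: bounded_linear_Blinfun_apply vector_field_def)
  qed
  ultimately show "\<exists>U F. open U \<and> x \<in> U \<and> smooth_open U F \<and> (\<forall>y\<in>M \<inter> U. F y = dird M f y (X y))"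
    using U V by (intro exI[of _ "U \<inter> V"] exI[of _ ?G]) auto
qed

text \<open>This is \<open>X (Y f) - Y (X f) = [X, Y] f\<close>. With a smooth extension \<open>F\<close> of \<open>f\<close>, the derivative of
  \<open>y \<mapsto> F'(y) (Y y)\<close> along \<open>X\<close> is \<open>F''(X, Y) + F' (D\<^sub>X Y)\<close>, and the second-order terms cancel by
  symmetry.\<close>

lemma dird_commutator:
  fixes f :: "'a::euclidean_space \<Rightarrow> 'b::euclidean_space"
  assumes f: "smooth_map M f" and X: "vector_field M X" and Y: "vector_field M Y" and x: "x \<in> M"
    and T: "dird M Y x (X x) - dird M X x (Y x) \<in> tangent_space M x"
  shows "dird M (\<lambda>y. dird M f y (Y y)) x (X x) - dird M (\<lambda>y. dird M f y (X y)) x (Y x) =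
    dird M f x (dird M Y x (X x) - dird M X x (Y x))"
proof -
  obtain U F where U: "open U" "x \<in> U" "smooth_open U F" "\<And>y. y \<in> M \<Longrightarrow> y \<in> U \<Longrightarrow> F y = f y"
    using smooth_mapE[OF f x] by blast
  let ?F' = "\<lambda>y. frechet_derivative F (at y)"
  have F': "dird M f y u = ?F' y u" if "y \<in> M" "y \<in> U" "u \<in> tangent_space M y" for y u
    using dird_tangent[OF smooth_map_has_derivative[OF U(1) that(2,1) U(3,4)] that(3)] by simp
  have lin: "linear (?F' x)" using smooth_openD(3)[OF U(3,2)] has_derivative_linear by blast
  have second: "dird M (\<lambda>y. dird M f y (Z y)) x v =
      frechet_derivative (\<lambda>y. ?F' y (Z x)) (at x) v + ?F' x (dird M Z x v)"
    if Z: "vector_field M Z" and v: "v \<in> tangent_space M x" for Z v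
  proof -
    let ?G = "\<lambda>y. Blinfun (?F' y)"
    have G: "smooth_open U ?G" by (rule smooth_open_blinfun_derivative[OF U(1,3)])
    have Gapp: "?G y u = ?F' y u" if "y \<in> U" for y u
      using has_derivative_bounded_linear[OF smooth_openD(3)[OF U(3) that]]
      by (simp add: bounded_linear_Blinfun_apply)
    have dG: "(?G has_derivative frechet_derivative ?G (at x)) (at x)"
      by (rule smooth_openD(3)[OF G U(2)])
    have Zd: "(Z has_derivative dird M Z x) (at x within M)"
      using Z x by (auto simp: vector_field_def intro: has_derivative_dird smooth_map_differentiable)
    have "((\<lambda>y. ?G y (Z y)) has_derivative
        (\<lambda>h. ?G x (dird M Z x h) + frechet_derivative ?G (at x) h (Z x))) (at x within M)"
      by (rule bounded_bilinear.FDERIV[OF bounded_bilinear_blinfun_apply has_derivative_at_withinI[OF dG] Zd])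
    note D = this
    obtain d where d: "d > 0" "ball x d \<subseteq> U" using U(1,2) openE by blast
    have "((\<lambda>y. dird M f y (Z y)) has_derivative
        (\<lambda>h. ?G x (dird M Z x h) + frechet_derivative ?G (at x) h (Z x))) (at x within M)"
      by (rule has_derivative_transform_within[OF D d(1) x])
        (use d F' Gapp Z in \<open>auto simp: subset_iff dist_commute vector_field_def\<close>)
    then have "dird M (\<lambda>y. dird M f y (Z y)) x v =
        ?F' x (dird M Z x v) + frechet_derivative ?G (at x) v (Z x)"
      by (simp add: dird_tangent[OF _ v] Gapp[OF U(2)])
    moreover have "frechet_derivative ?G (at x) v (Z x) = frechet_derivative (\<lambda>y. ?F' y (Z x)) (at x) v"
    proof -
      have "((\<lambda>y. ?G y (Z x)) has_derivative (\<lambda>h. frechet_derivative ?G (at x) h (Z x))) (at x)"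
        by (rule bounded_linear.has_derivative[OF _ dG]) simp
      from has_derivative_transform_within_open[OF this U(1,2)] Gapp
      have "((\<lambda>y. ?F' y (Z x)) has_derivative (\<lambda>h. frechet_derivative ?G (at x) h (Z x))) (at x)"
        by simp
      from fun_cong[OF frechet_derivative_at[OF this]] show ?thesis .
    qed
    ultimately show ?thesis by simp
  qed
  have "X x \<in> tangent_space M x" "Y x \<in> tangent_space M x"
    using X Y x by (auto simp: vector_field_def)
  then show ?thesis
    using second[OF Y] second[OF X] F'[OF x U(2) T]
      second_derivative_symmetric[OF U(1,2) smooth_openD(2)[OF U(3)], of "X x" "Y x"]
    by (simp add: linear_diff[OF lin])
qed

section \<open>Orthogonal projections for a positive operator\<close>

definition positive_operator :: "('a::euclidean_space \<Rightarrow>\<^sub>L 'a) \<Rightarrow> bool" where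
  "positive_operator G \<longleftrightarrow> (\<forall>u v. G u \<bullet> v = u \<bullet> G v) \<and> (\<forall>u. u \<noteq> 0 \<longrightarrow> u \<bullet> G u > 0)"

lemma positive_operator_inj:
  assumes "positive_operator G"
  shows "inj (blinfun_apply G)"
proof (rule injI)
  fix u v assume "G u = G v"
  then have "(u - v) \<bullet> G (u - v) = 0" by (simp add: blinfun.diff_right)
  then show "u = v" using assms unfolding positive_operator_def by (metis eq_iff_diff_eq_0 less_irrefl)
qed

text \<open>Two such projections differ by a vector of \<open>S\<close> that is orthogonal to \<open>S\<close>.\<close>

lemma metric_proj_eqI:
  fixes P :: "'a::euclidean_space \<Rightarrow>\<^sub>L 'a"
  assumes "positive_operator G" "subspace S" "\<And>v. P v \<in> S" "\<And>v s. s \<in> S \<Longrightarrow> (v - P v) \<bullet> G s = 0"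
  shows "metric_proj G S = P"
  unfolding metric_proj_def
proof (rule the_equality)
  fix P' :: "'a \<Rightarrow>\<^sub>L 'a" assume P': "\<forall>v. P' v \<in> S \<and> (\<forall>s\<in>S. (v - P' v) \<bullet> G s = 0)"
  show "P' = P"
  proof (rule blinfun_eqI)
    fix v
    have "P' v - P v \<in> S" using assms(2,3) P' by (simp add: subspace_diff)
    then have "(v - P v) \<bullet> G (P' v - P v) - (v - P' v) \<bullet> G (P' v - P v) = 0"
      using assms(4) P' by simp
    then have "(P' v - P v) \<bullet> G (P' v - P v) = 0" by (simp add: inner_diff_left)
    then show "P' v = P v"
      using assms(1) unfolding positive_operator_def by (metis eq_iff_diff_eq_0 less_irrefl)
  qed
qed (use assms in auto)

text \<open>For a projection \<open>R\<close> onto a subspace \<open>S\<close>, this operator represents the form that is \<open>G\<close> on \<open>S\<close>, the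
  ambient inner product on the kernel of \<open>R\<close>, and makes the two orthogonal to each other. It replaces
  the compression of \<open>G\<close> to \<open>S\<close>, which is invertible only as an operator on \<open>S\<close>.\<close>

definition proj_kernel :: "('a::euclidean_space \<Rightarrow>\<^sub>L 'a) \<Rightarrow> ('a \<Rightarrow>\<^sub>L 'a) \<Rightarrow> 'a \<Rightarrow>\<^sub>L 'a" where
  "proj_kernel G R = (blinfun_adj R o\<^sub>L (G o\<^sub>L R)) +
     (blinfun_adj (id_blinfun - R) o\<^sub>L (id_blinfun - R))"

lemma proj_kernel_positive:
  assumes "positive_operator G" "u \<noteq> 0"
  shows "u \<bullet> proj_kernel G R u > 0"
proof -
  have e: "u \<bullet> proj_kernel G R u = R u \<bullet> G (R u) + (u - R u) \<bullet> (u - R u)"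
    using blinfun_adj_inner[of R "G (R u)" u] blinfun_adj_inner[of "id_blinfun - R" "u - R u" u]
    by (simp add: proj_kernel_def blinfun.add_left blinfun.diff_left inner_add_right inner_commute)
  show ?thesis
  proof (cases "R u = 0")
    case True
    then show ?thesis using assms(2) by (simp add: e)
  next
    case False
    then have "R u \<bullet> G (R u) > 0" using assms(1) by (simp add: positive_operator_def)
    then show ?thesis by (simp add: e add_pos_nonneg)
  qed
qed

text \<open>Let \<open>z\<close> be the solution of \<open>K z = R* G v\<close>, where \<open>K\<close> is the operator \<open>proj_kernel G R\<close>. Paired with
  \<open>s \<in> S\<close>, the second summand of \<open>K z\<close> disappears because \<open>s - R s = 0\<close>, and what remains is
  \<open>G (R z) \<bullet> s = G v \<bullet> s\<close>.\<close>

lemma proj_kernel_solution: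
  fixes R :: "'a::euclidean_space \<Rightarrow>\<^sub>L 'a"
  assumes G: "positive_operator G" and R: "\<And>u. u \<in> S \<Longrightarrow> R u = u" and s: "s \<in> S"
  shows "(v - R (blinfun_inv (proj_kernel G R) (blinfun_adj R (G v)))) \<bullet> G s = 0"
proof -
  let ?K = "proj_kernel G R"
  have "inj (blinfun_apply ?K)"
  proof (rule injI)
    fix u v assume "?K u = ?K v"
    then have "(u - v) \<bullet> ?K (u - v) = 0" by (simp add: blinfun.diff_right)
    then show "u = v" using proj_kernel_positive[OF G, of "u - v" R] by (metis eq_iff_diff_eq_0 less_irrefl)
  qed
  note K = blinfun_inv(1)[OF this]
  define z where "z = blinfun_inv ?K (blinfun_adj R (G v))"
  have z: "?K z = blinfun_adj R (G v)" by (simp add: z_def K)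
  have G_sym: "G a \<bullet> b = a \<bullet> G b" for a b using G by (simp add: positive_operator_def)
  have "blinfun_adj R (G (R z)) \<bullet> s + blinfun_adj (id_blinfun - R) (z - R z) \<bullet> s = ?K z \<bullet> s"
    by (simp add: proj_kernel_def blinfun.add_left blinfun.diff_left inner_add_left)
  then have "G (R z) \<bullet> s = G v \<bullet> s"
    unfolding z blinfun_adj_inner by (simp add: R[OF s] blinfun.diff_left)
  then show ?thesis
    by (simp add: inner_diff_left G_sym z_def)
qed

text \<open>Any projection \<open>R\<close> onto \<open>S\<close> can be turned into the orthogonal one by operations that are smooth in
  \<open>G\<close> and \<open>R\<close>. With an arbitrary \<open>R\<close> this also proves that the orthogonal projection exists.\<close>

lemma metric_proj_formula:
  fixes R :: "'a::euclidean_space \<Rightarrow>\<^sub>L 'a"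
  assumes G: "positive_operator G" and S: "subspace S" and R: "\<And>u. R u \<in> S" "\<And>u. u \<in> S \<Longrightarrow> R u = u"
  shows "metric_proj G S = (R o\<^sub>L blinfun_inv (proj_kernel G R)) o\<^sub>L (blinfun_adj R o\<^sub>L G)"
  by (rule metric_proj_eqI[OF G S]) (simp_all add: R(1) proj_kernel_solution[OF G R(2)])

lemma subspace_has_projection:
  fixes S :: "'a::euclidean_space set"
  assumes "subspace S"
  obtains R :: "'a \<Rightarrow>\<^sub>L 'a" where "\<And>u. R u \<in> S" "\<And>u. u \<in> S \<Longrightarrow> R u = u"
proof -
  have "inj_on (\<lambda>v. v) S" by simp
  then obtain p where p: "range p \<subseteq> S" "linear p" "\<And>v. v \<in> S \<Longrightarrow> p v = v"
    using real_vector.linear_exists_left_inverse_on[OF linear_ident assms] by blast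
  have "bounded_linear p" using p(2) linear_conv_bounded_linear by blast
  with p that[of "Blinfun p"] show ?thesis by (auto simp: bounded_linear_Blinfun_apply)
qed

context
  fixes G :: "'a::euclidean_space \<Rightarrow>\<^sub>L 'a" and S :: "'a set"
  assumes G: "positive_operator G" and S: "subspace S"
begin

lemma metric_proj_in: "metric_proj G S v \<in> S"
  and metric_proj_orthogonal: "s \<in> S \<Longrightarrow> (v - metric_proj G S v) \<bullet> G s = 0"
proof -
  obtain R :: "'a \<Rightarrow>\<^sub>L 'a" where R: "\<And>u. R u \<in> S" "\<And>u. u \<in> S \<Longrightarrow> R u = u"
    using subspace_has_projection[OF S] by blast
  show "metric_proj G S v \<in> S" "s \<in> S \<Longrightarrow> (v - metric_proj G S v) \<bullet> G s = 0"
    by (simp_all add: metric_proj_formula[OF G S R] R(1) proj_kernel_solution[OF G R(2)])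
qed

lemma metric_proj_unique:
  assumes "p \<in> S" "\<And>s. s \<in> S \<Longrightarrow> (v - p) \<bullet> G s = 0"
  shows "metric_proj G S v = p"
proof -
  let ?d = "metric_proj G S v - p"
  have d: "?d \<in> S" using metric_proj_in assms(1) S by (simp add: subspace_diff)
  have "(v - p) \<bullet> G ?d - (v - metric_proj G S v) \<bullet> G ?d = 0"
    using assms(2)[OF d] metric_proj_orthogonal[OF d] by simp
  then have "?d \<bullet> G ?d = 0" by (simp add: inner_diff_left)
  then show ?thesis using G unfolding positive_operator_def by (metis eq_iff_diff_eq_0 less_irrefl)
qed

lemma metric_proj_fixes: "s \<in> S \<Longrightarrow> metric_proj G S s = s"
  by (rule metric_proj_unique) auto

lemma metric_proj_fixes_iff: "metric_proj G S v = v \<longleftrightarrow> v \<in> S"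
  using metric_proj_fixes metric_proj_in by metis

lemma metric_proj_idem: "metric_proj G S (metric_proj G S v) = metric_proj G S v"
  by (simp add: metric_proj_fixes metric_proj_in)

lemma metric_proj_inner: "s \<in> S \<Longrightarrow> metric_proj G S v \<bullet> G s = v \<bullet> G s"
  using metric_proj_orthogonal[of s v] by (simp add: inner_diff_left)

end

lemma metric_operator_positive: "metric_operator M g \<Longrightarrow> x \<in> M \<Longrightarrow> positive_operator (g x)"
  by (simp add: metric_operator_def positive_operator_def)

lemma smooth_map_proj_kernel:
  assumes "smooth_map M g" "smooth_map M R"
  shows "smooth_map M (\<lambda>y. proj_kernel (g y) (R y))"
  unfolding proj_kernel_def
  by (intro smooth_map_add smooth_map_bilinear[OF bounded_bilinear_blinfun_compose] assms
      smooth_map_bounded_linear[OF bounded_linear_blinfun_adj] smooth_map_diff smooth_map_const)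

section \<open>Tangent spaces of embedded submanifolds\<close>

text \<open>In a chart \<open>\<phi>\<close> with inverse \<open>\<psi>\<close> that maps \<open>M\<close> to the subspace \<open>S\<close>, take \<open>R y = \<psi>'(\<phi> y) p \<phi>'(y)\<close>
  for a linear projection \<open>p\<close> onto \<open>S\<close>. Its values are velocities of the images under \<open>\<psi>\<close> of straight
  lines in \<open>S\<close>. Conversely \<open>\<phi>\<close> maps curves in \<open>M\<close> to curves in \<open>S\<close>, whose velocities \<open>p\<close> fixes.\<close>

lemma tangent_projection_near:
  assumes "embedded_submanifold M" "x \<in> M"
  obtains U and R :: "'a::euclidean_space \<Rightarrow> 'a \<Rightarrow>\<^sub>L 'a" where "open U" "x \<in> U" "smooth_open U R"
    "\<And>y u. y \<in> M \<Longrightarrow> y \<in> U \<Longrightarrow> R y u \<in> tangent_space M y"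
    "\<And>y u. y \<in> M \<Longrightarrow> y \<in> U \<Longrightarrow> u \<in> tangent_space M y \<Longrightarrow> R y u = u"
proof -
  obtain U W S and \<phi> \<psi> :: "'a \<Rightarrow> 'a" where U: "open U" "x \<in> U" and W: "open W" and hom: "homeomorphism U W \<phi> \<psi>"
    and \<phi>: "smooth_open U \<phi>" and \<psi>: "smooth_open W \<psi>" and S: "subspace S"
    and im: "\<phi> ` (M \<inter> U) = W \<inter> S"
    using assms unfolding embedded_submanifold_def
    by metis
  have "inj_on (\<lambda>v. v) S" by simp
  then obtain p where p: "range p \<subseteq> S" "linear p" "\<And>v. v \<in> S \<Longrightarrow> p v = v"
    using real_vector.linear_exists_left_inverse_on[OF linear_ident S] by blast
  have bp: "bounded_linear p" using p(2) linear_conv_bounded_linear by blast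
  let ?A = "\<lambda>y. Blinfun (frechet_derivative \<phi> (at y))"
  let ?B = "\<lambda>z. Blinfun (frechet_derivative \<psi> (at z))"
  let ?R = "\<lambda>y. (?B (\<phi> y) o\<^sub>L Blinfun p) o\<^sub>L ?A y"
  have \<phi>d: "(\<phi> has_derivative ?A y) (at y)" if "y \<in> U" for y
    using smooth_openD(3)[OF \<phi> that] by (simp add: bounded_linear_Blinfun_apply has_derivative_bounded_linear)
  have \<psi>d: "(\<psi> has_derivative ?B z) (at z)" if "z \<in> W" for z
    using smooth_openD(3)[OF \<psi> that] by (simp add: bounded_linear_Blinfun_apply has_derivative_bounded_linear)
  have \<phi>U: "\<phi> ` U \<subseteq> W" and \<psi>\<phi>: "\<And>y. y \<in> U \<Longrightarrow> \<psi> (\<phi> y) = y" and \<phi>\<psi>: "\<And>z. z \<in> W \<Longrightarrow> \<psi> z \<in> U"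
    using hom by (auto simp: homeomorphism_def)
  \<comment> \<open>the derivatives of \<open>\<phi>\<close> and \<open>\<psi>\<close> are mutually inverse by the chain rule for \<open>\<psi> (\<phi> z) = z\<close>\<close>
  have BA: "?B (\<phi> y) (?A y u) = u" if y: "y \<in> U" for y u
  proof -
    have "((\<lambda>z. \<psi> (\<phi> z)) has_derivative (\<lambda>u. ?B (\<phi> y) (?A y u))) (at y)"
      using diff_chain_at[OF \<phi>d[OF y] \<psi>d[of "\<phi> y"]] \<phi>U y by (auto simp: o_def)
    from has_derivative_transform_within_open[OF this U(1) y] \<psi>\<phi>
    have "((\<lambda>z. z) has_derivative (\<lambda>u. ?B (\<phi> y) (?A y u))) (at y)" by simp
    from has_derivative_unique[OF this has_derivative_ident] show ?thesis by metis
  qed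
  have smooth: "smooth_open U ?R"
    by (intro smooth_open_bilinear[OF bounded_bilinear_blinfun_compose U(1)])
      (rule smooth_open_compose[OF U(1) W \<phi>U smooth_open_blinfun_derivative[OF W \<psi>] \<phi>]
        smooth_open_blinfun_derivative[OF U(1) \<phi>] | simp add: smooth_open_def Ck_on_const)+
  have into: "?R y u \<in> tangent_space M y" if y: "y \<in> M" "y \<in> U" for y u
  proof -
    define s where "s = p (?A y u)"
    have s: "s \<in> S" using p(1) by (auto simp: s_def)
    have \<phi>y: "\<phi> y \<in> W \<inter> S" using im y by blast
    then obtain e where e: "e > 0" "ball (\<phi> y) e \<subseteq> W" using W openE by blast
    \<comment> \<open>the line \<open>\<phi> y + t s\<close> stays in \<open>W\<close> for \<open>\<bar>t\<bar> < e'\<close>, also if \<open>s = 0\<close>\<close>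
    define e' where "e' = e / (norm s + 1)"
    have ns: "norm s + 1 > 0" by (simp add: add_nonneg_pos)
    have e': "e' > 0" using e ns by (simp add: e'_def)
    have inW: "\<phi> y + t *\<^sub>R s \<in> W" if "t \<in> {-e'<..<e'}" for t
    proof -
      have "\<bar>t\<bar> * norm s \<le> \<bar>t\<bar> * (norm s + 1)" by (simp add: mult_left_mono)
      also have "\<dots> < e' * (norm s + 1)"
        using that ns by (intro mult_strict_right_mono) auto
      also have "\<dots> = e" using ns by (simp add: e'_def)
      finally show ?thesis using e(2) by (auto simp: subset_iff dist_norm)
    qed
    let ?\<gamma> = "\<lambda>t. \<psi> (\<phi> y + t *\<^sub>R s)"
    have "?\<gamma> t \<in> M" if t: "t \<in> {-e'<..<e'}" for t
    proof -
      have "\<phi> y + t *\<^sub>R s \<in> \<phi> ` (M \<inter> U)"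
        using inW[OF t] \<phi>y s S by (auto simp: im intro: subspace_add subspace_scale)
      then show ?thesis using \<psi>\<phi> by auto
    qed
    moreover have "smooth_open {-e'<..<e'} ?\<gamma>"
    proof (rule smooth_open_compose[OF _ W _ \<psi>])
      show "smooth_open {-e'<..<e'} (\<lambda>t. \<phi> y + t *\<^sub>R s)"
        unfolding smooth_open_def
        by (intro allI Ck_on_add Ck_on_const open_greaterThanLessThan
            Ck_on_bounded_linear[OF bounded_linear_scaleR_left] Ck_on_id)
    qed (use inW in auto)
    moreover have "?\<gamma> 0 = y" using \<psi>\<phi> y by simp
    moreover have "(?\<gamma> has_vector_derivative ?R y u) (at 0)"
    proof -
      have 1: "((\<lambda>t. \<phi> y + t *\<^sub>R s) has_derivative (\<lambda>h. h *\<^sub>R s)) (at 0)"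
        by (auto intro!: derivative_eq_intros)
      have 2: "(\<psi> has_derivative ?B (\<phi> y)) (at (\<phi> y + 0 *\<^sub>R s))" using \<psi>d \<phi>y by simp
      have "(?\<gamma> has_derivative (\<lambda>h. ?B (\<phi> y) (h *\<^sub>R s))) (at 0)"
        using diff_chain_at[OF 1 2] by (simp add: o_def)
      then show ?thesis
        by (simp add: has_vector_derivative_def blinfun.scaleR_right s_def bounded_linear_Blinfun_apply[OF bp])
    qed
    ultimately show ?thesis using e' unfolding tangent_space_def by blast
  qed
  have fixes_T: "?R y u = u" if y: "y \<in> M" "y \<in> U" and u: "u \<in> tangent_space M y" for y u
  proof -
    obtain \<gamma> e where c: "e > 0" "\<gamma> ` {-e<..<e} \<subseteq> M" "\<gamma> 0 = y" "(\<gamma> has_vector_derivative u) (at (0::real))"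
      using tangent_velocity[OF u] by (auto simp: velocity_def)
    have \<phi>\<gamma>: "((\<lambda>t. \<phi> (\<gamma> t)) has_vector_derivative ?A y u) (at 0)"
      by (rule has_vector_derivative_along_curve[OF has_derivative_at_withinI[OF \<phi>d[OF y(2)]] c])
    have "((\<lambda>t. p (\<phi> (\<gamma> t))) has_vector_derivative p (?A y u)) (at 0)"
      by (rule bounded_linear.has_vector_derivative[OF bp \<phi>\<gamma>])
    moreover have "\<forall>\<^sub>F t in at 0. p (\<phi> (\<gamma> t)) = \<phi> (\<gamma> t)"
    proof -
      have "isCont \<gamma> 0" using c(4) has_vector_derivative_continuous by blast
      then have "\<forall>\<^sub>F t in at 0. \<gamma> t \<in> U"
        using U(1) y(2) c(3) unfolding isCont_def by (auto dest: topological_tendstoD)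
      moreover have "\<forall>\<^sub>F t in at 0. t \<in> {-e<..<e}"
        using c(1) by (intro eventually_at_in_open') auto
      ultimately show ?thesis
      proof eventually_elim
        case (elim t)
        then have "\<phi> (\<gamma> t) \<in> W \<inter> S" using c(2) im by blast
        then show ?case using p(3) by blast
      qed
    qed
    moreover have "p (\<phi> (\<gamma> 0)) = \<phi> (\<gamma> 0)" using im y c(3) p(3) by blast
    ultimately have "((\<lambda>t. \<phi> (\<gamma> t)) has_vector_derivative p (?A y u)) (at 0)"
      by (auto simp: has_vector_derivative_def intro: has_derivative_transform_eventually)
    then have "p (?A y u) = ?A y u" using \<phi>\<gamma> vector_derivative_unique_at by blast
    then show ?thesis using BA[OF y(2)] by (simp add: bounded_linear_Blinfun_apply[OF bp])
  qed
  show ?thesis by (rule that[OF U smooth into fixes_T])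
qed

lemma subspace_tangent_space:
  assumes "embedded_submanifold M" "x \<in> M"
  shows "subspace (tangent_space M x)"
proof -
  obtain U and R :: "'a \<Rightarrow> 'a \<Rightarrow>\<^sub>L 'a" where U: "open U" "x \<in> U" "smooth_open U R"
    and R: "\<And>y u. y \<in> M \<Longrightarrow> y \<in> U \<Longrightarrow> R y u \<in> tangent_space M y"
    "\<And>y u. y \<in> M \<Longrightarrow> y \<in> U \<Longrightarrow> u \<in> tangent_space M y \<Longrightarrow> R y u = u"
    by (rule tangent_projection_near[OF assms]) (rule that)
  have "tangent_space M x = range (R x)"
    using R[OF assms(2) U(2)] by (metis (no_types, opaque_lifting) image_subset_iff rangeI subsetI subset_antisym)
  then show ?thesis
    using linear_subspace_image[of "R x" UNIV] bounded_linear.linear blinfun.bounded_linear_right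
    by (metis subspace_UNIV)
qed

lemma smooth_map_Tproj:
  assumes M: "embedded_submanifold M" and g: "metric_operator M g"
  shows "smooth_map M (Tproj M g)"
proof (rule smooth_map_locally)
  fix x assume x: "x \<in> M"
  obtain U and R :: "'a \<Rightarrow> 'a \<Rightarrow>\<^sub>L 'a" where U: "open U" "x \<in> U" "smooth_open U R"
    and R: "\<And>y u. y \<in> M \<Longrightarrow> y \<in> U \<Longrightarrow> R y u \<in> tangent_space M y"
    "\<And>y u. y \<in> M \<Longrightarrow> y \<in> U \<Longrightarrow> u \<in> tangent_space M y \<Longrightarrow> R y u = u"
    by (rule tangent_projection_near[OF M x]) (rule that)
  have gU: "smooth_map (M \<inter> U) g" using g by (auto simp: metric_operator_def intro: smooth_map_subset)
  have RU: "smooth_map (M \<inter> U) R" by (rule smooth_map_of_smooth_open[OF U(1,3)]) simp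
  have KU: "smooth_map (M \<inter> U) (\<lambda>y. blinfun_inv (proj_kernel (g y) (R y)))"
    by (rule smooth_map_blinfun_inv[OF smooth_map_proj_kernel[OF gU RU]])
      (auto intro!: proj_kernel_positive metric_operator_positive[OF g])
  have "smooth_map (M \<inter> U) (\<lambda>y. (R y o\<^sub>L blinfun_inv (proj_kernel (g y) (R y))) o\<^sub>L (blinfun_adj (R y) o\<^sub>L g y))"
    by (intro smooth_map_bilinear[OF bounded_bilinear_blinfun_compose] gU RU KU
        smooth_map_bounded_linear[OF bounded_linear_blinfun_adj])
  then have "smooth_map (M \<inter> U) (Tproj M g)"
    by (rule smooth_map_cong[rotated])
      (auto simp: Tproj_def metric_proj_formula[OF metric_operator_positive[OF g] subspace_tangent_space[OF M] R])
  with U show "\<exists>U. open U \<and> x \<in> U \<and> smooth_map (M \<inter> U) (Tproj M g)" by blast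
qed

section \<open>The horizontal projection of a submersed ambient structure\<close>

locale submersed =
  fixes M :: "'a::euclidean_space set" and q :: "'a \<Rightarrow> 'b::euclidean_space" and B :: "'b set"
    and g :: "'a \<Rightarrow> 'a \<Rightarrow>\<^sub>L 'a" and gB :: "'b \<Rightarrow> 'b \<Rightarrow>\<^sub>L 'b"
  assumes submersed: "submersed_ambient_structure M q B g gB"
begin

abbreviation "P \<equiv> Tproj M g"
abbreviation "H \<equiv> Hproj M q g"
abbreviation "V \<equiv> Vproj M q g"
abbreviation "T \<equiv> tangent_space M"

lemma M: "embedded_submanifold M" and g: "metric_operator M g" and gB: "metric_operator B gB"
  and q: "smooth_map M q" and q_into: "q ` M \<subseteq> B"
  and isometry: "\<And>x u w. x \<in> M \<Longrightarrow> u \<in> horiz M q g x \<Longrightarrow> w \<in> horiz M q g x \<Longrightarrow>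
    dird M q x u \<bullet> gB (q x) (dird M q x w) = u \<bullet> g x w"
  using submersed by (auto simp: submersed_ambient_structure_def)

lemma g_smooth: "smooth_map M g" using g by (simp add: metric_operator_def)

context
  fixes x assumes x: "x \<in> M"
begin

lemma g_pos: "positive_operator (g x)"
  by (rule metric_operator_positive[OF g x])

lemma g_sym: "u \<bullet> g x v = v \<bullet> g x u"
  using g x by (metis metric_operator_def inner_commute)

lemma subspace_T: "subspace (T x)"
  by (rule subspace_tangent_space[OF M x])

lemma linear_dq: "linear (dird M q x)"
  using has_derivative_dird[OF smooth_map_differentiable[OF q x]] by (rule has_derivative_linear)

lemma subspace_vert: "subspace (vert M q x)"
  using subspace_T linear_dq
  by (auto simp: vert_def subspace_def linear_0 linear_add linear_cmul)

lemma subspace_horiz: "subspace (horiz M q g x)"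
  using subspace_T
  by (auto simp: horiz_def subspace_def inner_add_left)

lemma P_in: "P x u \<in> T x" and P_fixes: "u \<in> T x \<Longrightarrow> P x u = u" and P_fixes_iff: "P x u = u \<longleftrightarrow> u \<in> T x"
  and P_inner: "s \<in> T x \<Longrightarrow> P x u \<bullet> g x s = u \<bullet> g x s"
  unfolding Tproj_def using metric_proj_in[OF g_pos subspace_T] metric_proj_fixes[OF g_pos subspace_T]
    metric_proj_fixes_iff[OF g_pos subspace_T] metric_proj_inner[OF g_pos subspace_T] by auto

lemma H_in: "H x u \<in> horiz M q g x" and H_fixes: "u \<in> horiz M q g x \<Longrightarrow> H x u = u"
  and H_fixes_iff: "H x u = u \<longleftrightarrow> u \<in> horiz M q g x"
  and H_inner: "s \<in> horiz M q g x \<Longrightarrow> H x u \<bullet> g x s = u \<bullet> g x s"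
  and H_idem: "H x (H x u) = H x u"
  unfolding Hproj_def using metric_proj_in[OF g_pos subspace_horiz] metric_proj_fixes[OF g_pos subspace_horiz]
    metric_proj_fixes_iff[OF g_pos subspace_horiz] metric_proj_inner[OF g_pos subspace_horiz]
    metric_proj_idem[OF g_pos subspace_horiz] by auto

lemma V_in: "V x u \<in> vert M q x" and V_fixes: "u \<in> vert M q x \<Longrightarrow> V x u = u"
  and V_inner: "s \<in> vert M q x \<Longrightarrow> V x u \<bullet> g x s = u \<bullet> g x s"
  and V_unique: "p \<in> vert M q x \<Longrightarrow> (\<And>s. s \<in> vert M q x \<Longrightarrow> (u - p) \<bullet> g x s = 0) \<Longrightarrow> V x u = p"
  unfolding Vproj_def using metric_proj_in[OF g_pos subspace_vert] metric_proj_fixes[OF g_pos subspace_vert]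
    metric_proj_inner[OF g_pos subspace_vert] metric_proj_unique[OF g_pos subspace_vert] by auto

lemma horiz_T: "u \<in> horiz M q g x \<Longrightarrow> u \<in> T x" and vert_T: "u \<in> vert M q x \<Longrightarrow> u \<in> T x"
  and horiz_vert: "u \<in> horiz M q g x \<Longrightarrow> w \<in> vert M q x \<Longrightarrow> u \<bullet> g x w = 0"
  and dq_vert: "w \<in> vert M q x \<Longrightarrow> dird M q x w = 0"
  by (auto simp: horiz_def vert_def)

text \<open>The vector \<open>P u - V u\<close> is tangent and orthogonal to all vertical vectors, hence horizontal, and
  \<open>u\<close> differs from it by vectors orthogonal to the horizontal space.\<close>

lemma P_decomposition: "P x u = H x u + V x u"
proof -
  have "P x u - V x u \<in> horiz M q g x"
  proof -
    have "P x u - V x u \<in> T x"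
      using P_in vert_T[OF V_in] subspace_T by (simp add: subspace_diff)
    moreover have "(P x u - V x u) \<bullet> g x s = 0" if "s \<in> vert M q x" for s
      using V_inner[OF that, of u] P_inner[OF vert_T[OF that], of u] by (simp add: inner_diff_left)
    ultimately show ?thesis by (simp add: horiz_def)
  qed
  moreover have "(u - (P x u - V x u)) \<bullet> g x s = 0" if s: "s \<in> horiz M q g x" for s
    using P_inner[OF horiz_T[OF s], of u] horiz_vert[OF s V_in, of u] g_sym[of s "V x u"]
    by (simp add: inner_diff_left)
  ultimately have "H x u = P x u - V x u"
    unfolding Hproj_def by (rule metric_proj_unique[OF g_pos subspace_horiz])
  then show ?thesis by simp
qed

lemma vertI: "u \<in> T x \<Longrightarrow> H x u = 0 \<Longrightarrow> u \<in> vert M q x"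
  using P_decomposition[of u] P_fixes[of u] V_in[of u] by simp

lemma dq_P: "dird M q x (P x u) = dird M q x (H x u)"
  by (simp add: P_decomposition linear_add[OF linear_dq] dq_vert[OF V_in])

end

text \<open>The differential of \<open>q\<close> extended by zero on the vertical space and on the normal space. Unlike
  \<open>dird M q\<close>, which is meaningful on tangent vectors only, it is an operator-valued function that can
  itself be differentiated along \<open>M\<close>.\<close>

definition dqH :: "'a \<Rightarrow> 'a \<Rightarrow>\<^sub>L 'b" where
  "dqH x = Blinfun (\<lambda>u. dird M q x (H x u))"

lemma dqH_apply: "x \<in> M \<Longrightarrow> dqH x u = dird M q x (H x u)"
proof -
  assume x: "x \<in> M"
  have "bounded_linear (\<lambda>u. dird M q x (H x u))"
    by (rule bounded_linear_compose[OF linear_conv_bounded_linear[THEN iffD1, OF linear_dq[OF x]]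
          blinfun.bounded_linear_right])
  then show ?thesis by (simp add: dqH_def bounded_linear_Blinfun_apply)
qed

text \<open>By \<open>dq_P\<close>, \<open>dqH\<close> is also \<open>dq P\<close>, which is smooth already because \<open>P\<close> is; in this way the smoothness
  of \<open>dqH\<close> can be used to prove that of \<open>H\<close>.\<close>

lemma smooth_dqH: "smooth_map M dqH"
proof (rule smooth_map_locally)
  fix x assume x: "x \<in> M"
  obtain U F where U: "open U" "x \<in> U" "smooth_open U F" "\<And>y. y \<in> M \<Longrightarrow> y \<in> U \<Longrightarrow> F y = q y"
    using smooth_mapE[OF q x] by blast
  have "smooth_map (M \<inter> U) (\<lambda>y. Blinfun (frechet_derivative F (at y)) o\<^sub>L P y)"
    by (intro smooth_map_bilinear[OF bounded_bilinear_blinfun_compose]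
        smooth_map_of_smooth_open[OF U(1) smooth_open_blinfun_derivative[OF U(1,3)]]
        smooth_map_subset[OF smooth_map_Tproj[OF M g]]) auto
  moreover have "Blinfun (frechet_derivative F (at y)) o\<^sub>L P y = dqH y" if "y \<in> M \<inter> U" for y
  proof (rule blinfun_eqI)
    fix u
    have y: "y \<in> M" "y \<in> U" using that by auto
    show "(Blinfun (frechet_derivative F (at y)) o\<^sub>L P y) u = dqH y u"
      using dird_tangent[OF smooth_map_has_derivative[OF U(1) y(2,1) U(3,4)] P_in[OF y(1), of u]]
        has_derivative_bounded_linear[OF smooth_openD(3)[OF U(3) y(2)]]
      by (simp add: bounded_linear_Blinfun_apply dqH_apply[OF y(1)] dq_P[OF y(1), symmetric])
  qed
  ultimately have "smooth_map (M \<inter> U) dqH" by (rule smooth_map_cong[rotated])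
  with U show "\<exists>U. open U \<and> x \<in> U \<and> smooth_map (M \<inter> U) dqH" by blast
qed

text \<open>Since \<open>dq\<close> is isometric on horizontal vectors and vanishes on vertical ones, the form
  \<open>(e, u) \<mapsto> \<langle>dqH e, g\<^sub>B dqH u\<rangle>\<close> equals \<open>\<langle>H e, g (H u)\<rangle> = \<langle>e, g (H u)\<rangle>\<close>.\<close>

lemma H_formula:
  assumes x: "x \<in> M"
  shows "H x = blinfun_inv (g x) o\<^sub>L (blinfun_adj (dqH x) o\<^sub>L (gB (q x) o\<^sub>L dqH x))"
proof (rule blinfun_eqI)
  fix u
  have "g x (H x u) = blinfun_adj (dqH x) (gB (q x) (dqH x u))"
  proof (rule vector_eq_ldot[THEN iffD1], rule allI)
    fix e
    have "e \<bullet> blinfun_adj (dqH x) (gB (q x) (dqH x u)) = dqH x e \<bullet> gB (q x) (dqH x u)"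
      using blinfun_adj_inner by (metis inner_commute)
    also have "\<dots> = H x e \<bullet> g x (H x u)"
      by (simp add: dqH_apply[OF x] isometry[OF x] H_in[OF x])
    also have "\<dots> = e \<bullet> g x (H x u)" by (rule H_inner[OF x H_in[OF x]])
    finally show "e \<bullet> g x (H x u) = e \<bullet> blinfun_adj (dqH x) (gB (q x) (dqH x u))" by simp
  qed
  then show "H x u = (blinfun_inv (g x) o\<^sub>L (blinfun_adj (dqH x) o\<^sub>L (gB (q x) o\<^sub>L dqH x))) u"
    using blinfun_inv(2)[OF positive_operator_inj[OF g_pos[OF x]], of "H x u"] by simp
qed

lemma smooth_H: "smooth_map M H"
proof -
  have "smooth_map M (\<lambda>x. blinfun_inv (g x) o\<^sub>L (blinfun_adj (dqH x) o\<^sub>L (gB (q x) o\<^sub>L dqH x)))"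
    using gB g_pos
    by (intro smooth_map_bilinear[OF bounded_bilinear_blinfun_compose] smooth_map_blinfun_inv g_smooth
        smooth_map_bounded_linear[OF bounded_linear_blinfun_adj] smooth_dqH
        smooth_map_compose[OF q q_into]) (auto simp: metric_operator_def positive_operator_def)
  then show ?thesis by (rule smooth_map_cong[rotated]) (simp add: H_formula)
qed

lemma smooth_V: "smooth_map M V"
proof (rule smooth_map_cong)
  show "smooth_map M (\<lambda>x. P x - H x)" by (intro smooth_map_diff smooth_map_Tproj M g smooth_H)
  show "P x - H x = V x" if "x \<in> M" for x
    by (rule blinfun_eqI) (simp add: P_decomposition[OF that] blinfun.diff_left)
qed

end

section \<open>The Levi-Civita connection in ambient coordinates\<close>

lemma smooth_map_apply:
  "smooth_map M A \<Longrightarrow> smooth_map M X \<Longrightarrow> smooth_map M (\<lambda>y. blinfun_apply (A y) (X y))"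
  by (rule smooth_map_bilinear[OF bounded_bilinear_blinfun_apply])

lemma dird_apply:
  assumes "smooth_map M A" "smooth_map M X" "x \<in> M" "v \<in> tangent_space M x"
  shows "dird M (\<lambda>y. blinfun_apply (A y) (X y)) x v = A x (dird M X x v) + dird M A x v (X x)"
  by (intro dird_bilinear[OF bounded_bilinear_blinfun_apply] smooth_map_differentiable assms)

lemma dird_apply_const:
  assumes "smooth_map M A" "x \<in> M" "v \<in> tangent_space M x"
  shows "dird M (\<lambda>y. blinfun_apply (A y) u) x v = dird M A x v u"
  using dird_apply[OF assms(1) smooth_map_const assms(2,3)] by (simp add: dird_const assms)

lemma dird_metric:
  assumes "smooth_map M g" "smooth_map M Y" "smooth_map M Z" "x \<in> M" "v \<in> tangent_space M x"
  shows "dird M (\<lambda>y. Y y \<bullet> blinfun_apply (g y) (Z y)) x v =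
    dird M Y x v \<bullet> g x (Z x) + Y x \<bullet> g x (dird M Z x v) + Y x \<bullet> dird M g x v (Z x)"
proof -
  have "dird M (\<lambda>y. Y y \<bullet> blinfun_apply (g y) (Z y)) x v =
      Y x \<bullet> dird M (\<lambda>y. g y (Z y)) x v + dird M Y x v \<bullet> g x (Z x)"
    by (intro dird_bilinear[OF bounded_bilinear_inner] smooth_map_differentiable smooth_map_apply assms)
  then show ?thesis
    by (simp add: dird_apply assms inner_add_right)
qed

text \<open>Symmetry of \<open>g y\<close> at all points of \<open>M\<close> passes to the derivative.\<close>

lemma dird_metric_operator_sym:
  assumes g: "metric_operator M g" and x: "x \<in> M" "v \<in> tangent_space M x"
  shows "a \<bullet> dird M g x v b = b \<bullet> dird M g x v a"
proof -
  have "smooth_map M g" using g by (simp add: metric_operator_def)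
  have m: "dird M (\<lambda>y. a \<bullet> blinfun_apply (g y) b) x v = a \<bullet> dird M g x v b" for a b
    using dird_metric[OF \<open>smooth_map M g\<close> smooth_map_const smooth_map_const x]
    by (simp add: dird_const x)
  have "dird M (\<lambda>y. a \<bullet> blinfun_apply (g y) b) x = dird M (\<lambda>y. b \<bullet> blinfun_apply (g y) a) x"
    using g by (intro dird_cong x) (metis metric_operator_def inner_commute)
  then show ?thesis using m by metis
qed

text \<open>For a torsion-free connection the bracket is the difference \<open>\<nabla>\<^sub>X Y - \<nabla>\<^sub>Y X\<close> of two vector fields.\<close>

lemma bracket_tangent:
  assumes "levi_civita M g nabla" "vector_field M X" "vector_field M Y" "embedded_submanifold M" "x \<in> M"
  shows "dird M Y x (X x) - dird M X x (Y x) \<in> tangent_space M x"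
proof -
  have "vector_field M (nabla X Y)" "vector_field M (nabla Y X)"
    using assms(1-3) by (auto simp: levi_civita_def affine_connection_def)
  then have "nabla X Y x - nabla Y X x \<in> tangent_space M x"
    using assms(5) subspace_tangent_space[OF assms(4,5)] by (auto simp: vector_field_def subspace_diff)
  then show ?thesis using assms by (simp add: levi_civita_def)
qed

text \<open>In the Koszul formula the brackets and the derivatives of inner products are expanded in ambient
  derivatives. All derivatives of \<open>X\<close> and \<open>Z\<close> cancel, as do those of \<open>Y\<close> along \<open>Z\<close>, so that the right-hand
  side depends only on the values of the fields at \<open>x\<close> and on the derivative of \<open>Y\<close> along \<open>X\<close>.\<close>

lemma koszul_ambient:
  assumes nabla: "levi_civita M g nabla" and g: "metric_operator M g" and x: "x \<in> M"
    and X: "vector_field M X" and Y: "vector_field M Y" and Z: "vector_field M Z"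
  shows "2 * (nabla X Y x \<bullet> g x (Z x)) = 2 * (dird M Y x (X x) \<bullet> g x (Z x)) +
    Y x \<bullet> dird M g x (X x) (Z x) + X x \<bullet> dird M g x (Y x) (Z x) - X x \<bullet> dird M g x (Z x) (Y x)"
proof -
  have gs: "smooth_map M g" using g by (simp add: metric_operator_def)
  have sym: "a \<bullet> g x b = b \<bullet> g x a" for a b
    using g x by (metis metric_operator_def inner_commute)
  have metric: "dird M Y' x (X' x) \<bullet> g x (Z' x) + Y' x \<bullet> g x (dird M Z' x (X' x)) + Y' x \<bullet> dird M g x (X' x) (Z' x) =
      nabla X' Y' x \<bullet> g x (Z' x) + Y' x \<bullet> g x (nabla X' Z' x)"
    if "vector_field M X'" "vector_field M Y'" "vector_field M Z'" for X' Y' Z'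
    using nabla that x dird_metric[OF gs _ _ x, of Y' Z' "X' x"]
    by (auto simp: levi_civita_def vector_field_def)
  have torsion: "nabla X' Y' x \<bullet> g x c - nabla Y' X' x \<bullet> g x c = dird M Y' x (X' x) \<bullet> g x c - dird M X' x (Y' x) \<bullet> g x c"
    if "vector_field M X'" "vector_field M Y'" for X' Y' c
    using nabla that x by (simp add: levi_civita_def inner_diff_left[symmetric])
  show ?thesis
    using metric[OF X Y Z] metric[OF Y X Z] metric[OF Z X Y]
      torsion[OF X Y, of "Z x"] torsion[OF X Z, of "Y x"] torsion[OF Y Z, of "X x"]
      sym[of "Y x"] sym[of "X x"] sym[of "Z x"]
    by simp
qed

section \<open>Horizontal brackets and the O'Neill tensor\<close>

context submersed
begin

lemma vector_field_H: "smooth_map M X \<Longrightarrow> vector_field M (\<lambda>y. H y (X y))"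
  by (simp add: vector_field_def smooth_map_apply smooth_H H_in horiz_T)

lemma vector_field_V: "smooth_map M X \<Longrightarrow> vector_field M (\<lambda>y. V y (X y))"
  by (simp add: vector_field_def smooth_map_apply smooth_V V_in vert_T)

text \<open>The derivative of the identity \<open>H H = H\<close>.\<close>

lemma dird_H_split:
  assumes "x \<in> M" "v \<in> T x"
  shows "dird M H x v u = H x (dird M H x v u) + dird M H x v (H x u)"
proof -
  have "dird M (\<lambda>y. H y o\<^sub>L H y) x v = (H x o\<^sub>L dird M H x v) + (dird M H x v o\<^sub>L H x)"
    by (intro dird_bilinear[OF bounded_bilinear_blinfun_compose] smooth_map_differentiable smooth_H assms)
  moreover have "dird M (\<lambda>y. H y o\<^sub>L H y) x = dird M H x"
    by (intro dird_cong assms blinfun_eqI) (simp add: H_idem)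
  ultimately have "dird M H x v u = ((H x o\<^sub>L dird M H x v) + (dird M H x v o\<^sub>L H x)) u" by simp
  then show ?thesis by (simp add: blinfun.add_left)
qed

lemma H_dird_H:
  assumes "x \<in> M" "v \<in> T x" "u \<in> horiz M q g x"
  shows "H x (dird M H x v u) = 0"
  using dird_H_split[OF assms(1,2), of u] H_fixes[OF assms(1,3)] by simp

text \<open>The metric of \<open>B\<close>, pulled back to \<open>M\<close>, is constant along the fibres of \<open>q\<close>.\<close>

lemma dird_base_metric_vertical:
  assumes x: "x \<in> M" and Z: "Z \<in> vert M q x"
  shows "dird M (\<lambda>y. gB (q y)) x Z = 0"
proof -
  have "q x \<in> B" using x q_into by blast
  then have "(gB has_derivative dird B gB (q x)) (at (q x) within B)"
    using gB by (intro has_derivative_dird smooth_map_differentiable) (auto simp: metric_operator_def)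
  then have "(gB has_derivative dird B gB (q x)) (at (q x) within q ` M)"
    using q_into by (rule has_derivative_subset)
  with has_derivative_dird[OF smooth_map_differentiable[OF q x]]
  have "((gB \<circ> q) has_derivative (dird B gB (q x) \<circ> dird M q x)) (at x within M)"
    by (rule diff_chain_within)
  from dird_tangent[OF this vert_T[OF x Z]] has_derivative_linear[OF \<open>(gB has_derivative _) (at (q x) within B)\<close>]
  show ?thesis by (simp add: o_def dq_vert[OF x Z] linear_0)
qed

end

locale submersed_levi_civita = submersed M q B g gB
  for M :: "'a::euclidean_space set" and q :: "'a \<Rightarrow> 'b::euclidean_space" and B g gB +
  fixes nabla :: "('a \<Rightarrow> 'a) \<Rightarrow> ('a \<Rightarrow> 'a) \<Rightarrow> 'a \<Rightarrow> 'a"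
  assumes nabla: "levi_civita M g nabla"
begin

text \<open>The vector is the bracket of the horizontal fields \<open>y \<mapsto> H\<^sub>y v\<close> and \<open>y \<mapsto> H\<^sub>y w\<close> at \<open>x\<close>, hence tangent; and \<open>H\<close>
  annihilates both terms.\<close>

lemma bracket_vertical:
  assumes x: "x \<in> M" and v: "v \<in> horiz M q g x" and w: "w \<in> horiz M q g x"
  shows "dird M H x v w - dird M H x w v \<in> vert M q x"
proof (rule vertI[OF x])
  have T: "v \<in> T x" "w \<in> T x" using v w horiz_T[OF x] by auto
  show "dird M H x v w - dird M H x w v \<in> T x"
    using bracket_tangent[OF nabla vector_field_H[OF smooth_map_const[of M v]]
        vector_field_H[OF smooth_map_const[of M w]] M x] H_fixes[OF x] v w
    by (simp add: dird_apply_const[OF smooth_H x] T)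
  show "H x (dird M H x v w - dird M H x w v) = 0"
    using H_dird_H[OF x] T v w by (simp add: blinfun.diff_right)
qed

text \<open>As \<open>dq\<close> vanishes on the field \<open>y \<mapsto> V\<^sub>y Z\<close>, the derivative of \<open>dq (H v)\<close> along \<open>Z\<close> is \<open>dq\<close> of the bracket of the two
  fields, and the isometry turns its product with \<open>dq w\<close> into a product with \<open>w\<close> in \<open>M\<close>.\<close>

lemma dird_dq_horizontal:
  assumes x: "x \<in> M" and Z: "Z \<in> vert M q x" and v: "v \<in> horiz M q g x" and w: "w \<in> horiz M q g x"
  shows "dird M (\<lambda>y. dird M q y (H y v)) x Z \<bullet> gB (q x) (dird M q x w) =
    (dird M H x Z v - dird M V x v Z) \<bullet> g x w"
proof -
  let ?X = "\<lambda>y. H y v" and ?Z = "\<lambda>y. V y Z"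
  have X: "vector_field M ?X" by (rule vector_field_H[OF smooth_map_const])
  have Zf: "vector_field M ?Z" by (rule vector_field_V[OF smooth_map_const])
  have vals: "?X x = v" "?Z x = Z" using H_fixes V_fixes x v Z by auto
  have T: "v \<in> T x" "Z \<in> T x" using v Z horiz_T vert_T x by auto
  \<comment> \<open>the bracket of the vertical field \<open>?Z\<close> and the horizontal field \<open>?X\<close>\<close>
  have br: "dird M ?X x (?Z x) - dird M ?Z x (?X x) = dird M H x Z v - dird M V x v Z"
    by (simp add: vals dird_apply_const[OF smooth_H x] dird_apply_const[OF smooth_V x] T)
  have t: "dird M H x Z v - dird M V x v Z \<in> T x" (is "?t \<in> _")
    using bracket_tangent[OF nabla Zf X M x] br by simp
  have "dird M (\<lambda>y. dird M q y (?Z y)) x = dird M (\<lambda>y. 0) x"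
    by (intro dird_cong x) (simp add: dq_vert V_in)
  then have "dird M (\<lambda>y. dird M q y (?X y)) x Z = dird M q x ?t"
    using dird_commutator[OF q Zf X x] t br by (simp add: vals dird_const T)
  also have "\<dots> = dird M q x (H x ?t)"
    using dq_P[OF x, of ?t] P_fixes[OF x t] by simp
  finally show ?thesis
    using isometry[OF x H_in[OF x] w, of ?t] H_inner[OF x w, of ?t] by simp
qed

text \<open>Because the submersion is Riemannian, the Lie derivative of the metric along a vertical field
  vanishes on horizontal vectors; this is what makes the symmetric part of the O'Neill tensor zero
  on them. Differentiating the isometry condition for the fields
  \<open>H v\<close> and \<open>H w\<close> along \<open>Z\<close> expresses \<open>v \<bullet> (D\<^sub>Z g) w\<close> by derivatives of \<open>V\<close>, since the derivatives of
  \<open>H\<close> along \<open>Z\<close> cancel with those in \<open>dird_dq_horizontal\<close>; differentiating the orthogonality of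
  horizontal and vertical fields exchanges the derivatives of \<open>V\<close> for derivatives of \<open>g\<close> and \<open>H\<close>.\<close>

lemma vertical_metric_derivative:
  assumes x: "x \<in> M" and Z: "Z \<in> vert M q x" and v: "v \<in> horiz M q g x" and w: "w \<in> horiz M q g x"
  shows "v \<bullet> dird M g x Z w = Z \<bullet> dird M g x v w + Z \<bullet> g x (dird M H x v w) +
    Z \<bullet> dird M g x w v + Z \<bullet> g x (dird M H x w v)"
proof -
  have T: "v \<in> T x" "w \<in> T x" "Z \<in> T x" using v w Z horiz_T vert_T x by auto
  have fx: "H x v = v" "H x w = w" "V x Z = Z" using H_fixes V_fixes x v w Z by auto
  have Hs: "smooth_map M (\<lambda>y. H y u)" and Vs: "smooth_map M (\<lambda>y. V y u)" for u
    by (intro smooth_map_apply smooth_H smooth_V smooth_map_const)+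
  have dqs: "smooth_map M (\<lambda>y. dird M q y (H y u))" for u
    by (intro smooth_map_dird q vector_field_H smooth_map_const)
  have gBs: "smooth_map M (\<lambda>y. gB (q y))"
    using gB by (intro smooth_map_compose[OF q q_into]) (auto simp: metric_operator_def)
  have gB_sym: "a \<bullet> gB (q x) b = b \<bullet> gB (q x) a" for a b
    using gB x q_into by (metis image_subset_iff inner_commute metric_operator_def)
  have "dird M (\<lambda>y. H y v \<bullet> g y (H y w)) x =
      dird M (\<lambda>y. dird M q y (H y v) \<bullet> gB (q y) (dird M q y (H y w))) x"
    by (intro dird_cong x) (simp add: isometry H_in)
  then have "dird M H x Z v \<bullet> g x w + v \<bullet> g x (dird M H x Z w) + v \<bullet> dird M g x Z w =
      dird M (\<lambda>y. dird M q y (H y v)) x Z \<bullet> gB (q x) (dird M q x w) +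
      dird M q x v \<bullet> gB (q x) (dird M (\<lambda>y. dird M q y (H y w)) x Z)"
    using dird_metric[OF g_smooth Hs Hs x T(3), of v w] dird_metric[OF gBs dqs dqs x T(3), of v w]
    by (simp add: fx dird_apply_const[OF smooth_H x T(3)] dird_base_metric_vertical[OF x Z])
  then have *: "v \<bullet> dird M g x Z w = - (dird M V x v Z \<bullet> g x w) - dird M V x w Z \<bullet> g x v"
    using dird_dq_horizontal[OF x Z v w] dird_dq_horizontal[OF x Z w v]
      gB_sym[of "dird M q x v"] g_sym[OF x, of v]
    by (simp add: inner_diff_left)
  have orth: "dird M V x v' Z \<bullet> g x w' + Z \<bullet> g x (dird M H x v' w') + Z \<bullet> dird M g x v' w' = 0"
    if v': "v' \<in> T x" and w': "w' \<in> horiz M q g x" for v' w'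
  proof -
    have "dird M (\<lambda>y. V y Z \<bullet> g y (H y w')) x = dird M (\<lambda>y. 0) x"
      using horiz_vert[OF _ H_in V_in] g_sym by (intro dird_cong x) simp
    then show ?thesis
      using dird_metric[OF g_smooth Vs Hs x v', of Z w'] H_fixes[OF x w']
      by (simp add: fx dird_apply_const[OF smooth_H x v'] dird_apply_const[OF smooth_V x v'] dird_const v')
  qed
  \<comment> \<open>the two terms of \<open>*\<close> are traded by \<open>orth\<close>, once for each order of \<open>v\<close> and \<open>w\<close>\<close>
  show ?thesis using * orth[OF T(1) w] orth[OF T(2) v] by simp
qed

text \<open>Paired with a vertical \<open>Z\<close>, the derivative of \<open>\<eta>\<close> drops out of the Koszul formula because it enters
  through \<open>H (D \<eta>)\<close>. By \<open>vertical_metric_derivative\<close> the derivatives of the metric then combine to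
  \<open>- \<langle>(D\<^sub>v H) w + (D\<^sub>w H) v, g Z\<rangle>\<close>, where \<open>v\<close>, \<open>w\<close> are the values of \<open>\<xi>\<close>, \<open>\<eta>\<close> at \<open>x\<close>.\<close>

lemma V_nabla_horizontal:
  assumes x: "x \<in> M" and xi: "vector_field M \<xi>" and eta: "vector_field M \<eta>"
    and v: "\<xi> x \<in> horiz M q g x" and w: "\<eta> x \<in> horiz M q g x"
  shows "V x (nabla \<xi> (\<lambda>y. H y (\<eta> y)) x) =
    (1/2) *\<^sub>R (dird M H x (\<xi> x) (\<eta> x) - dird M H x (\<eta> x) (\<xi> x))"
proof (rule V_unique[OF x])
  let ?v = "\<xi> x" and ?w = "\<eta> x" and ?Y = "\<lambda>y. H y (\<eta> y)"
  show "(1/2) *\<^sub>R (dird M H x ?v ?w - dird M H x ?w ?v) \<in> vert M q x"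
    by (intro subspace_scale[OF subspace_vert[OF x]] bracket_vertical x v w)
  fix Z assume Z: "Z \<in> vert M q x"
  have T: "?v \<in> T x" "?w \<in> T x" "Z \<in> T x" using v w Z horiz_T vert_T x by auto
  have fx: "H x ?w = ?w" "V x Z = Z" using H_fixes V_fixes x w Z by auto
  have etas: "smooth_map M \<eta>" using eta by (simp add: vector_field_def)
  have Y: "vector_field M ?Y" by (rule vector_field_H[OF etas])
  have Zf: "vector_field M (\<lambda>y. V y Z)" by (rule vector_field_V[OF smooth_map_const])
  have dY: "dird M ?Y x ?v \<bullet> g x Z = dird M H x ?v ?w \<bullet> g x Z"
    using horiz_vert[OF x H_in[OF x] Z, of "dird M \<eta> x ?v"]
    by (simp add: dird_apply[OF smooth_H etas x T(1)] inner_add_left)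
  have "2 * (nabla \<xi> ?Y x \<bullet> g x Z) = 2 * (dird M H x ?v ?w \<bullet> g x Z) +
      ?w \<bullet> dird M g x ?v Z + ?v \<bullet> dird M g x ?w Z - ?v \<bullet> dird M g x Z ?w"
    using koszul_ambient[OF nabla g x xi Y Zf] dY by (simp add: fx)
  also have "\<dots> = dird M H x ?v ?w \<bullet> g x Z - dird M H x ?w ?v \<bullet> g x Z"
    using vertical_metric_derivative[OF x Z v w] dird_metric_operator_sym[OF g x T(1), of ?w Z]
      dird_metric_operator_sym[OF g x T(2), of ?v Z] g_sym[OF x, of Z] by simp
  finally show "(nabla \<xi> ?Y x - (1/2) *\<^sub>R (dird M H x ?v ?w - dird M H x ?w ?v)) \<bullet> g x Z = 0"
    by (simp add: inner_diff_left)
qed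

text \<open>By \<open>V_nabla_horizontal\<close> all extensions of \<open>v\<close> and \<open>w\<close> give this value. That it is the only value with this
  property requires some extension to exist, and \<open>y \<mapsto> H\<^sub>y v\<close>, \<open>y \<mapsto> H\<^sub>y w\<close> are global ones.\<close>

lemma oneill_horizontal:
  assumes x: "x \<in> M" and v: "v \<in> horiz M q g x" and w: "w \<in> horiz M q g x"
  shows "oneill M q g nabla x v w = (1/2) *\<^sub>R (dird M H x v w - dird M H x w v)"
  unfolding oneill_def
proof (rule the_equality)
  show "\<forall>\<xi> \<eta>. vector_field M \<xi> \<longrightarrow> vector_field M \<eta> \<longrightarrow> \<xi> x = v \<longrightarrow> \<eta> x = w \<longrightarrow>
      V x (nabla \<xi> (\<lambda>y. H y (\<eta> y)) x) = (1/2) *\<^sub>R (dird M H x v w - dird M H x w v)"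
    using V_nabla_horizontal[OF x] v w by blast
next
  fix a
  assume a: "\<forall>\<xi> \<eta>. vector_field M \<xi> \<longrightarrow> vector_field M \<eta> \<longrightarrow> \<xi> x = v \<longrightarrow> \<eta> x = w \<longrightarrow>
      V x (nabla \<xi> (\<lambda>y. H y (\<eta> y)) x) = a"
  have f: "vector_field M (\<lambda>y. H y u)" for u by (rule vector_field_H[OF smooth_map_const])
  show "a = (1/2) *\<^sub>R (dird M H x v w - dird M H x w v)"
    using a[rule_format, OF f f, of v w] V_nabla_horizontal[OF x f f, of v w] H_fixes[OF x] v w by simp
qed

end

section \<open>The flip of the horizontal bundle\<close>

context submersed
begin

lemma THM_iff: "(x, v, \<Delta>m, \<Delta>t) \<in> THM M q g \<longleftrightarrow> x \<in> M \<and> v \<in> horiz M q g x \<and> \<Delta>m \<in> T x \<and>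
    dird M H x \<Delta>m v + H x \<Delta>t = \<Delta>t"
  by (auto simp: THM_def HM_def H_fixes_iff P_fixes_iff)

lemma QHM_iff: "(x, v, \<Delta>m, \<Delta>t) \<in> QHM M q g \<longleftrightarrow> x \<in> M \<and> v \<in> horiz M q g x \<and>
    \<Delta>m \<in> horiz M q g x \<and> dird M H x \<Delta>m v + H x \<Delta>t = \<Delta>t"
  by (auto simp: QHM_def THM_iff H_fixes_iff dest: horiz_T)

lemma jH_in_QHM:
  assumes "p \<in> THM M q g"
  shows "jH M q g p \<in> QHM M q g"
proof -
  obtain x v m t where p: "p = (x, v, m, t)" by (cases p)
  have x: "x \<in> M" and v: "v \<in> horiz M q g x" using assms by (auto simp: p THM_iff)
  show ?thesis
    using dird_H_split[OF x horiz_T[OF x v], of m]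
    by (simp add: p jH_def QHM_iff x v H_in[OF x] H_idem[OF x] blinfun.add_right add_ac)
qed

lemma jH_involution:
  assumes "p \<in> QHM M q g"
  shows "jH M q g (jH M q g p) = p"
proof -
  obtain x v m t where p: "p = (x, v, m, t)" by (cases p)
  have x: "x \<in> M" and v: "v \<in> horiz M q g x" and m: "m \<in> horiz M q g x"
    and t: "dird M H x m v + H x t = t" using assms by (auto simp: p QHM_iff)
  show ?thesis
    using H_dird_H[OF x horiz_T[OF x v] m] t
    by (simp add: p jH_def H_fixes[OF x] v m H_idem[OF x] blinfun.add_right)
qed

text \<open>For a curve \<open>\<gamma>\<close> in \<open>M\<close> with velocity \<open>\<Delta>m\<close>, the curve \<open>(\<gamma> s, H (v + s \<Delta>t))\<close>, with \<open>H\<close> taken at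
  \<open>\<gamma> s\<close>, lies in the horizontal bundle, and its velocity is \<open>(\<Delta>m, \<Delta>t)\<close> exactly by the equation
  defining \<open>THM\<close>. So these are indeed tangent vectors of the horizontal bundle, and the
  derivative of \<open>dq\<close> on them is determined.\<close>

lemma velocity_HM:
  assumes "(x, v, \<Delta>m, \<Delta>t) \<in> THM M q g"
  shows "velocity (HM M q g) (x, v) (\<Delta>m, \<Delta>t)"
proof -
  have x: "x \<in> M" and v: "v \<in> horiz M q g x" and m: "\<Delta>m \<in> T x"
    and t: "dird M H x \<Delta>m v + H x \<Delta>t = \<Delta>t" using assms by (auto simp: THM_iff)
  obtain \<gamma> e where c: "e > 0" "\<gamma> ` {-e<..<e} \<subseteq> M" "\<gamma> 0 = x" "(\<gamma> has_vector_derivative \<Delta>m) (at (0::real))"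
    using tangent_velocity[OF m] by (auto simp: velocity_def)
  let ?c = "\<lambda>s. (\<gamma> s, H (\<gamma> s) (v + s *\<^sub>R \<Delta>t))"
  have 1: "((\<lambda>s. H (\<gamma> s)) has_vector_derivative dird M H x \<Delta>m) (at 0)"
    by (rule has_vector_derivative_along_curve[OF has_derivative_dird[OF
            smooth_map_differentiable[OF smooth_H x]] c])
  have 2: "((\<lambda>s. v + s *\<^sub>R \<Delta>t) has_vector_derivative \<Delta>t) (at 0)"
    by (auto intro!: derivative_eq_intros)
  have "((\<lambda>s. H (\<gamma> s) (v + s *\<^sub>R \<Delta>t)) has_vector_derivative H x \<Delta>t + dird M H x \<Delta>m v) (at 0)"
    using bounded_bilinear.has_vector_derivative[OF bounded_bilinear_blinfun_apply 1 2] c(3) by simp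
  then have "(?c has_vector_derivative (\<Delta>m, \<Delta>t)) (at 0)"
    using has_vector_derivative_Pair[OF c(4)] t by (simp add: add.commute)
  moreover have "?c ` {-e<..<e} \<subseteq> HM M q g"
    using c(2) by (auto simp: HM_def H_idem image_subset_iff)
  moreover have "?c 0 = (x, v)" by (simp add: c(3) H_fixes[OF x v])
  ultimately show ?thesis using c(1) unfolding velocity_def by blast
qed

text \<open>On the horizontal bundle \<open>dq\<close> is the map \<open>(y, u) \<mapsto> (q y, dqH y u)\<close>, to which the product rule applies.\<close>

lemma dird_dq:
  assumes p: "(x, v, \<Delta>m, \<Delta>t) \<in> THM M q g"
  shows "dird (HM M q g) (dq M q) (x, v) (\<Delta>m, \<Delta>t) =
    (dird M q x \<Delta>m, dird M (\<lambda>y. dird M q y (H y v)) x \<Delta>m + dird M q x (H x \<Delta>t))"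
proof -
  have x: "x \<in> M" and v: "v \<in> horiz M q g x" and m: "\<Delta>m \<in> T x" using p by (auto simp: THM_iff)
  let ?HM = "HM M q g"
  have fst_d: "(fst has_derivative fst) (at (x, v) within ?HM)"
    and snd_d: "(snd has_derivative snd) (at (x, v) within ?HM)"
    by (auto intro!: derivative_eq_intros)
  have chain: "((\<lambda>p. f (fst p)) has_derivative (\<lambda>h. dird M f x (fst h))) (at (x, v) within ?HM)"
    if "smooth_map M f" for f :: "'a \<Rightarrow> 'c::real_normed_vector"
  proof -
    have "(f has_derivative dird M f x) (at (fst (x, v)) within fst ` ?HM)"
      using has_derivative_dird[OF smooth_map_differentiable[OF that x]]
      by (auto simp: HM_def intro: has_derivative_subset)
    from diff_chain_within[OF fst_d this] show ?thesis by (simp add: o_def)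
  qed
  have "((\<lambda>p. (q (fst p), dqH (fst p) (snd p))) has_derivative
      (\<lambda>h. (dird M q x (fst h), dqH x (snd h) + dird M dqH x (fst h) v))) (at (x, v) within ?HM)"
    using bounded_bilinear.FDERIV[OF bounded_bilinear_blinfun_apply chain[OF smooth_dqH] snd_d]
    by (intro has_derivative_Pair chain q) simp
  then have "(dq M q has_derivative
      (\<lambda>h. (dird M q x (fst h), dqH x (snd h) + dird M dqH x (fst h) v))) (at (x, v) within ?HM)"
    by (rule has_derivative_transform[rotated 2])
      (use x v in \<open>auto simp: HM_def dq_def dqH_apply H_fixes\<close>)
  from dird_velocity[OF this velocity_HM[OF p]]
  have "dird ?HM (dq M q) (x, v) (\<Delta>m, \<Delta>t) = (dird M q x \<Delta>m, dqH x \<Delta>t + dird M dqH x \<Delta>m v)"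
    by simp
  moreover have "dird M (\<lambda>y. dqH y v) x = dird M (\<lambda>y. dird M q y (H y v)) x"
    by (intro dird_cong x) (simp add: dqH_apply)
  ultimately show ?thesis
    using dird_apply_const[OF smooth_dqH x m, of v] by (simp add: dqH_apply[OF x])
qed

lemma d2q_eq:
  assumes "(x, v, \<Delta>m, \<Delta>t) \<in> THM M q g"
  shows "d2q M q g (x, v, \<Delta>m, \<Delta>t) = (q x, dird M q x v, dird M q x \<Delta>m,
    dird M (\<lambda>y. dird M q y (H y v)) x \<Delta>m + dird M q x (H x \<Delta>t))"
  by (simp add: d2q_def dq_def[of M q] dird_dq[OF assms, unfolded dq_def[of M q]])

end

context submersed_levi_civita
begin

lemma jH_oneill:
  assumes "(x, v, \<Delta>m, \<Delta>t) \<in> QHM M q g"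
  shows "jH M q g (x, v, \<Delta>m, \<Delta>t) = (x, H x \<Delta>m, v, 2 *\<^sub>R oneill M q g nabla x v \<Delta>m + \<Delta>t)"
proof -
  have x: "x \<in> M" and v: "v \<in> horiz M q g x" and m: "\<Delta>m \<in> horiz M q g x"
    and t: "dird M H x \<Delta>m v + H x \<Delta>t = \<Delta>t" using assms by (auto simp: QHM_iff)
  have "dird M H x v \<Delta>m + H x \<Delta>t = (dird M H x v \<Delta>m - dird M H x \<Delta>m v) + (dird M H x \<Delta>m v + H x \<Delta>t)"
    by simp
  then show ?thesis by (simp add: jH_def oneill_horizontal[OF x v m] t)
qed

text \<open>The two second-order components differ by \<open>dq\<close> of the vertical vector of \<open>bracket_vertical\<close>.\<close>

lemma d2q_flip:
  assumes p: "(x, v, \<delta>m, \<delta>t) \<in> QHM M q g" and d: "d2q M q g (x, v, \<delta>m, \<delta>t) = (b, w, \<delta>b, \<delta>w)"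
  shows "d2q M q g (x, \<delta>m, v, dird M H x v \<delta>m + H x \<delta>t) = (b, \<delta>b, w, \<delta>w)"
proof -
  have x: "x \<in> M" and v: "v \<in> horiz M q g x" and m: "\<delta>m \<in> horiz M q g x" using p by (auto simp: QHM_iff)
  have p': "(x, v, \<delta>m, \<delta>t) \<in> THM M q g" using p by (simp add: QHM_def)
  have T: "v \<in> T x" "\<delta>m \<in> T x" using horiz_T[OF x] v m by auto
  have "jH M q g (x, v, \<delta>m, \<delta>t) = (x, \<delta>m, v, dird M H x v \<delta>m + H x \<delta>t)"
    by (simp add: jH_def H_fixes[OF x m])
  with jH_in_QHM[OF p'] have f: "(x, \<delta>m, v, dird M H x v \<delta>m + H x \<delta>t) \<in> THM M q g"
    by (simp add: QHM_def)
  have fields: "vector_field M (\<lambda>y. H y u)" for u by (rule vector_field_H[OF smooth_map_const])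
  have br: "dird M (\<lambda>y. H y \<delta>m) x v - dird M (\<lambda>y. H y v) x \<delta>m =
      dird M H x v \<delta>m - dird M H x \<delta>m v"
    by (simp add: dird_apply_const[OF smooth_H x] T)
  note vertical = bracket_vertical[OF x v m]
  have "dird M (\<lambda>y. dird M q y (H y \<delta>m)) x v = dird M (\<lambda>y. dird M q y (H y v)) x \<delta>m"
    using dird_commutator[OF q fields fields x, of \<delta>m v]
    by (simp add: H_fixes[OF x] v m br vert_T[OF x vertical] dq_vert[OF x vertical])
  moreover have "H x (dird M H x v \<delta>m + H x \<delta>t) = H x \<delta>t"
    by (simp add: blinfun.add_right H_dird_H[OF x T(1) m] H_idem[OF x])
  ultimately show ?thesis
    using d by (simp add: d2q_eq[OF p'] d2q_eq[OF f])
qed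

end

theorem proposition7:
  fixes M :: "'a::euclidean_space set" and B :: "'b::euclidean_space set"
    and q :: "'a \<Rightarrow> 'b" and g :: "'a \<Rightarrow> 'a \<Rightarrow>\<^sub>L 'a" and gB :: "'b \<Rightarrow> 'b \<Rightarrow>\<^sub>L 'b"
    and nabla :: "('a \<Rightarrow> 'a) \<Rightarrow> ('a \<Rightarrow> 'a) \<Rightarrow> 'a \<Rightarrow> 'a"
  assumes "submersed_ambient_structure M q B g gB"
    and "levi_civita M g nabla"
  shows "(\<forall>p \<in> THM M q g. jH M q g p \<in> QHM M q g) \<and>
    (\<forall>x v \<Delta>m \<Delta>t. (x, v, \<Delta>m, \<Delta>t) \<in> QHM M q g \<longrightarrow>
       jH M q g (x, v, \<Delta>m, \<Delta>t) =
         (x, Hproj M q g x \<Delta>m, v, 2 *\<^sub>R oneill M q g nabla x v \<Delta>m + \<Delta>t)) \<and>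
    (\<forall>p \<in> QHM M q g. jH M q g (jH M q g p) = p) \<and>
    (\<forall>x v \<delta>m \<delta>t b w \<delta>b \<delta>w. (x, v, \<delta>m, \<delta>t) \<in> QHM M q g \<longrightarrow>
       d2q M q g (x, v, \<delta>m, \<delta>t) = (b, w, \<delta>b, \<delta>w) \<longrightarrow>
       d2q M q g (x, \<delta>m, v, dird M (Hproj M q g) x v \<delta>m + Hproj M q g x \<delta>t) =
         (b, \<delta>b, w, \<delta>w))"
proof -
  interpret submersed_levi_civita M q B g gB nabla
    using assms by unfold_locales
  show ?thesis
    using jH_in_QHM jH_oneill jH_involution d2q_flip by blast
qed

end
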